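(* Let $n,m\ge 1$ be integers and let $H_1,\ldots,H_m\in\mathbb{R}^{n\times n}$. For $z=(z_1,\ldots,z_m)\in\mathbb{T}^m$, where $\mathbb{T}=\{w\in\mathbb{C}:|w|=1\}$, consider the univariate polynomial of degree $n$ in $z_0$ $$p_z(z_0)=\det\Big(z_0 I_n+\sum_{k=1}^m z_k H_k\Big)=\sum_{l=0}^n p_l(z)\,z_0^l ,$$ and let $H(z_1,\ldots,z_m)$ be the discrete-time Hermite matrix of $p_z$, an $n\times n$ Hermitian matrix whose entries are trigonometric polynomials in $z_1,\ldots,z_m$. Then the delay difference equation $$x(t)+\sum_{k=1}^m H_k\,x(t-\tau_k)=0,\qquad x(t)\in\mathbb{R}^n,$$ is strongly stable if and only if $H(z_1,\ldots,z_m)\succ 0$ (positive definite) for all $(z_1,\ldots,z_m)\in\mathbb{T}^m$.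
   Context: Strong stability: the difference equation $x(t)+\sum_{k=1}^m H_k x(t-\tau_k)=0$ is called strongly stable if it is exponentially stable independently of the values of the delays, i.e. for every choice of delays $\tau_1,\ldots,\tau_m>0$. Discrete-time Hermite matrix (also called Schur-Cohn or Schur-Fujiwara matrix): for a polynomial $p(w)=p_0+p_1w+\cdots+p_nw^n$ with complex coefficients, let $S_1(p)$ be the $n\times n$ upper triangular Toeplitz matrix with first row $(p_n,p_{n-1},\ldots,p_1)$ and let $S_2(p)$ be the $n\times n$ upper triangular Toeplitz matrix with first row $(p_0,p_1,\ldots,p_{n-1})$. The Hermite matrix of $p$ is the $n\times n$ Hermitian matrix $$H(p)=S_1(p)^*S_1(p)-S_2(p)^T\,\overline{S_2(p)},$$ where $^*$ denotes conjugate transpose, $^T$ transpose and the bar entrywise complex conjugation. For real coefficients this is $S_1^TS_1-S_2^TS_2$. In the claim, $H(z_1,\ldots,z_m)=H(p_z)$, the matrix obtained from the coefficients $p_l=p_l(z)$. *)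

theory Defs
  imports
    "HOL-Analysis.Analysis"
    "HOL-Computational_Algebra.Polynomial"
    "Jordan_Normal_Form.Matrix"
begin

no_notation Matrix.vec_index (infixl \<open>$\<close> 100)
no_notation Matrix.scalar_prod (infix \<open>\<bullet>\<close> 70)

text \<open>
  The coefficient matrices live in \<open>real ^ 'n ^ 'n\<close> and are indexed by a finite type \<open>'m\<close>, so that
  \<open>n = CARD('n)\<close> and \<open>m = CARD('m)\<close>. Toeplitz matrices need an ordered index set; the Hermite
  matrix is therefore a matrix over the index set \<open>{0..<n}\<close> in the sense of
  \<^theory>\<open>Jordan_Normal_Form.Matrix\<close>.
\<close>

definition max_delay :: "('m::finite \<Rightarrow> real) \<Rightarrow> real" where
  "max_delay \<tau> = Max (range \<tau>)"

text \<open>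
  As usual for difference equations, the state space is the set of continuous functions \<open>\<phi>\<close> on
  \<open>[- max_delay \<tau>, 0]\<close> satisfying the compatibility condition
  \<open>\<phi> 0 + (\<Sum>k. H k *v \<phi> (- \<tau> k)) = 0\<close> (the equation at \<open>t = 0\<close>), so that solutions are continuous.
  The values of \<open>x\<close> to the left of \<open>- max_delay \<tau>\<close> are irrelevant.
\<close>

definition dde_solution ::
    "('m::finite \<Rightarrow> real ^ 'n ^ 'n) \<Rightarrow> ('m \<Rightarrow> real) \<Rightarrow> (real \<Rightarrow> real ^ 'n) \<Rightarrow> bool" where
  "dde_solution H \<tau> x \<longleftrightarrow>
     continuous_on {- max_delay \<tau>..} x \<and>
     (\<forall>t\<ge>0. x t + (\<Sum>k\<in>UNIV. H k *v x (t - \<tau> k)) = 0)"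

definition exponentially_stable ::
    "('m::finite \<Rightarrow> real ^ 'n ^ 'n) \<Rightarrow> ('m \<Rightarrow> real) \<Rightarrow> bool" where
  "exponentially_stable H \<tau> \<longleftrightarrow>
     (\<exists>M \<alpha>. \<alpha> > 0 \<and>
        (\<forall>x. dde_solution H \<tau> x \<longrightarrow>
           (\<forall>t\<ge>0. norm (x t) \<le> M * exp (- \<alpha> * t) * (SUP s\<in>{- max_delay \<tau>..0}. norm (x s)))))"

definition strongly_stable :: "('m::finite \<Rightarrow> real ^ 'n ^ 'n) \<Rightarrow> bool" where
  "strongly_stable H \<longleftrightarrow> (\<forall>\<tau>. (\<forall>k. \<tau> k > 0) \<longrightarrow> exponentially_stable H \<tau>)"

text \<open>
  The determinant is taken over the ring of complex polynomials in \<open>z\<^sub>0\<close>, the latter being the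
  polynomial \<open>[:0, 1:]\<close>; see \<open>poly_char_poly_at\<close> for its values.
\<close>

definition char_poly_at :: "('m::finite \<Rightarrow> real ^ 'n ^ 'n) \<Rightarrow> ('m \<Rightarrow> complex) \<Rightarrow> complex poly" where
  "char_poly_at H z =
     Determinants.det (Finite_Cartesian_Product.mat [:0, 1:] +
       (\<chi> i j. [:\<Sum>k\<in>UNIV. z k * complex_of_real (H k $ i $ j):]))"

lemma poly_char_poly_at:
  "poly (char_poly_at H z) z0 =
     Determinants.det (Finite_Cartesian_Product.mat z0 +
       (\<chi> i j. \<Sum>k\<in>UNIV. z k * complex_of_real (H k $ i $ j)))"
  unfolding char_poly_at_def Determinants.det_def
  by (simp add: poly_sum poly_prod Finite_Cartesian_Product.mat_def if_distrib[of "\<lambda>p. poly p z0"]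
      cong: if_cong)

definition upper_toeplitz :: "nat \<Rightarrow> (nat \<Rightarrow> 'a::zero) \<Rightarrow> 'a Matrix.mat" where
  "upper_toeplitz n r = Matrix.mat n n (\<lambda>(i, j). if i \<le> j then r (j - i) else 0)"

text \<open>The argument \<open>n\<close> is the (formal) degree of \<open>p\<close>.\<close>

definition hermite_mat :: "nat \<Rightarrow> complex poly \<Rightarrow> complex Matrix.mat" where
  "hermite_mat n p =
     (let S1 = upper_toeplitz n (\<lambda>l. coeff p (n - l));
          S2 = upper_toeplitz n (\<lambda>l. coeff p l)
      in map_mat cnj (transpose_mat S1) * S1 - transpose_mat S2 * map_mat cnj S2)"

definition positive_definite_mat :: "complex Matrix.mat \<Rightarrow> bool" where
  "positive_definite_mat A \<longleftrightarrow>
     map_mat cnj (transpose_mat A) = A \<and>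
     (\<forall>v \<in> carrier_vec (dim_row A). v \<noteq> 0\<^sub>v (dim_row A) \<longrightarrow> Re ((A *\<^sub>v v) \<bullet>c v) > 0)"

end

theory Submission
  imports
    Defs
    "HOL-Complex_Analysis.Great_Picard"
    "HOL-Computational_Algebra.Fundamental_Theorem_Algebra"
    "HOL-Real_Asymp.Real_Asymp"
begin

text \<open>
  Both sides are equivalent to: for every \<open>z\<close> on the torus all roots of \<open>p\<^sub>z\<close> lie in the open unit disc.

  For the Hermite matrix this is the Schur-Cohn criterion. Splitting off a root \<open>a\<close> of \<open>p\<close> changes
  the Hermitian form by \<open>(1 - |a|\<^sup>2)\<close> times the squared modulus of a linear functional, because
  \<open>|x - a y|\<^sup>2 - |y - cnj a x|\<^sup>2 = (1 - |a|\<^sup>2) (|x|\<^sup>2 - |y|\<^sup>2)\<close> telescopes along shifts.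

  If some \<open>p\<^sub>z\<close> has a root of modulus at least one, suitable delays admit an exponential solution that
  does not decay: for modulus one the delays are chosen to match the phases exactly, otherwise
  nearly equal delays and Hurwitz' theorem give a nearby characteristic root.

  Conversely, let \<open>A(z) = \<Sum>k. z\<^sub>k H\<^sub>k\<close>. By compactness \<open>A(z)\<^sup>N\<close> decays geometrically in \<open>N\<close>, uniformly
  on the torus, hence so do its Fourier coefficients, of which there are only polynomially many.
  Iterating the equation \<open>N\<close> times therefore expresses \<open>x(t)\<close> through earlier values with
  coefficients of total norm at most \<open>1/2\<close>, which forces exponential decay.
\<close>

section \<open>The Schur-Cohn criterion\<close>

text \<open>
  On sequences vanishing from \<open>N\<close> on, \<open>rev_conv n p\<close> and \<open>cnj_conv n p\<close> act as \<open>S\<^sub>1\<close> and \<open>cnj S\<^sub>2\<close>. The length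
  \<open>N\<close> is kept apart from the degree \<open>n\<close> so that roots can be split off without shortening the sequences.
\<close>
definition rev_conv :: "nat \<Rightarrow> complex poly \<Rightarrow> (nat \<Rightarrow> complex) \<Rightarrow> nat \<Rightarrow> complex" where
  "rev_conv n p v k = (\<Sum>l\<le>n. coeff p (n - l) * v (k + l))"

definition cnj_conv :: "nat \<Rightarrow> complex poly \<Rightarrow> (nat \<Rightarrow> complex) \<Rightarrow> nat \<Rightarrow> complex" where
  "cnj_conv n p v k = (\<Sum>l\<le>n. cnj (coeff p l) * v (k + l))"

definition hermite_form :: "nat \<Rightarrow> nat \<Rightarrow> complex poly \<Rightarrow> (nat \<Rightarrow> complex) \<Rightarrow> real" where
  "hermite_form N n p v =
     (\<Sum>k<N. (cmod (rev_conv n p v k))\<^sup>2) - (\<Sum>k<N. (cmod (cnj_conv n p v k))\<^sup>2)"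

lemma coeff_linear_mult:
  fixes p :: "'a::comm_ring_1 poly"
  shows "coeff ([:-a, 1:] * p) l = (if l = 0 then 0 else coeff p (l - 1)) - a * coeff p l"
  by (cases l) (auto simp: coeff_pCons)

text \<open>Let S be the shift of sequences. Since \<open>rev_conv\<close> reads coefficients from
  the top, the factor X - a acts on it as 1 - a S; on \<open>cnj_conv\<close>, which reads from the
  bottom, it acts as S - cnj a.\<close>

lemma rev_conv_linear_mult:
  assumes "degree p \<le> n"
  shows "rev_conv (Suc n) ([:-a, 1:] * p) v k = rev_conv n p v k - a * rev_conv n p v (Suc k)"
proof -
  have "rev_conv (Suc n) ([:-a, 1:] * p) v k =
      (\<Sum>l\<le>Suc n. (if l = Suc n then 0 else coeff p (n - l)) * v (k + l)) -
      (\<Sum>l\<le>Suc n. a * coeff p (Suc n - l) * v (k + l))"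
    unfolding rev_conv_def coeff_linear_mult sum_subtractf[symmetric]
    by (rule sum.cong) (auto simp: algebra_simps Suc_diff_le)
  also have "(\<Sum>l\<le>Suc n. (if l = Suc n then 0 else coeff p (n - l)) * v (k + l)) = rev_conv n p v k"
    unfolding rev_conv_def by (simp add: atMost_Suc)
  also have "(\<Sum>l\<le>Suc n. a * coeff p (Suc n - l) * v (k + l)) = a * rev_conv n p v (Suc k)"
    unfolding rev_conv_def sum.atMost_Suc_shift using assms
    by (simp add: coeff_eq_0 sum_distrib_left mult.assoc)
  finally show ?thesis .
qed

lemma cnj_conv_linear_mult:
  assumes "degree p \<le> n"
  shows "cnj_conv (Suc n) ([:-a, 1:] * p) v k = cnj_conv n p v (Suc k) - cnj a * cnj_conv n p v k"
proof -
  have "cnj_conv (Suc n) ([:-a, 1:] * p) v k =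
      (\<Sum>l\<le>Suc n. (if l = 0 then 0 else cnj (coeff p (l - 1))) * v (k + l)) -
      (\<Sum>l\<le>Suc n. cnj a * cnj (coeff p l) * v (k + l))"
    unfolding cnj_conv_def coeff_linear_mult sum_subtractf[symmetric]
    by (rule sum.cong) (auto simp: algebra_simps)
  also have "(\<Sum>l\<le>Suc n. (if l = 0 then 0 else cnj (coeff p (l - 1))) * v (k + l)) = cnj_conv n p v (Suc k)"
    unfolding cnj_conv_def sum.atMost_Suc_shift by simp
  also have "(\<Sum>l\<le>Suc n. cnj a * cnj (coeff p l) * v (k + l)) = cnj a * cnj_conv n p v k"
    unfolding cnj_conv_def using assms
    by (simp add: atMost_Suc coeff_eq_0 sum_distrib_left mult.assoc)
  finally show ?thesis .
qed

lemma cnj_conv_linear_comb: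
  "cnj_conv n p (\<lambda>k. c * u k + d * v k) k = c * cnj_conv n p u k + d * cnj_conv n p v k"
  unfolding cnj_conv_def by (simp add: sum_distrib_left sum.distrib algebra_simps)

lemma rev_conv_linear_comb:
  "rev_conv n p (\<lambda>k. c * u k + d * v k) k = c * rev_conv n p u k + d * rev_conv n p v k"
  unfolding rev_conv_def by (simp add: sum_distrib_left sum.distrib algebra_simps)

lemma rev_conv_Suc: "rev_conv n p (\<lambda>k. v (Suc k)) k = rev_conv n p v (Suc k)"
  and cnj_conv_Suc: "cnj_conv n p (\<lambda>k. v (Suc k)) k = cnj_conv n p v (Suc k)"
  unfolding rev_conv_def cnj_conv_def by simp_all

lemma cmod_reflection_identity:
  "(cmod (x - a * y))\<^sup>2 - (cmod (y - cnj a * x))\<^sup>2 = (1 - (cmod a)\<^sup>2) * ((cmod x)\<^sup>2 - (cmod y)\<^sup>2)"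
  unfolding cmod_power2 by (simp add: algebra_simps power2_eq_square)

lemma sum_reflection_identity:
  fixes v :: "nat \<Rightarrow> complex"
  assumes "v N = 0"
  shows "(\<Sum>k<N. (cmod (v k - a * v (Suc k)))\<^sup>2) - (\<Sum>k<N. (cmod (v (Suc k) - cnj a * v k))\<^sup>2) =
    (1 - (cmod a)\<^sup>2) * (cmod (v 0))\<^sup>2"
proof -
  have "(\<Sum>k<N. (cmod (v k))\<^sup>2 - (cmod (v (Suc k)))\<^sup>2) = (cmod (v 0))\<^sup>2 - (cmod (v N))\<^sup>2"
    by (rule sum_lessThan_telescope')
  then show ?thesis
    using assms by (simp add: sum_subtractf[symmetric] cmod_reflection_identity sum_distrib_left[symmetric])
qed

lemma rev_conv_eq_0: "(\<And>k. k \<ge> N \<Longrightarrow> v k = 0) \<Longrightarrow> k \<ge> N \<Longrightarrow> rev_conv n p v k = 0"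
  and cnj_conv_eq_0: "(\<And>k. k \<ge> N \<Longrightarrow> v k = 0) \<Longrightarrow> k \<ge> N \<Longrightarrow> cnj_conv n p v k = 0"
  unfolding rev_conv_def cnj_conv_def by (auto intro!: sum.neutral)

text \<open>Write R and C for \<open>rev_conv n p v\<close> and \<open>cnj_conv n p v\<close>. The
  form is the sum of |R - a S R|^2 - |S C - cnj a C|^2. Replacing the first square by |S R - cnj a
  R|^2 gives the form of \<open>p\<close> at (S - cnj a) v, and
  \<open>sum_reflection_identity\<close> evaluates the difference.\<close>

lemma hermite_form_peel_cnj:
  assumes "degree p \<le> n" "\<And>k. k \<ge> N \<Longrightarrow> v k = 0"
  shows "hermite_form N (Suc n) ([:-a, 1:] * p) v =
    hermite_form N n p (\<lambda>k. v (Suc k) - cnj a * v k) + (1 - (cmod a)\<^sup>2) * (cmod (rev_conv n p v 0))\<^sup>2"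
proof -
  have 1: "rev_conv n p (\<lambda>k. v (Suc k) - cnj a * v k) k = rev_conv n p v (Suc k) - cnj a * rev_conv n p v k" for k
    using rev_conv_linear_comb[of n p 1 "\<lambda>k. v (Suc k)" "- cnj a" v k] by (simp add: rev_conv_Suc)
  have 2: "cnj_conv n p (\<lambda>k. v (Suc k) - cnj a * v k) k = cnj_conv n p v (Suc k) - cnj a * cnj_conv n p v k" for k
    using cnj_conv_linear_comb[of n p 1 "\<lambda>k. v (Suc k)" "- cnj a" v k] by (simp add: cnj_conv_Suc)
  have "rev_conv n p v N = 0"
    using assms(2) by (intro rev_conv_eq_0[of N]) auto
  then show ?thesis
    using sum_reflection_identity[of "rev_conv n p v" N a]
    unfolding hermite_form_def 1 2 rev_conv_linear_mult[OF assms(1)] cnj_conv_linear_mult[OF assms(1)]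
    by simp
qed

text \<open>The dual splitting: here the second square is replaced, by |C - a S C|^2, so the form of
  \<open>p\<close> appears at (1 - a S) v and the boundary term comes from
  \<open>cnj_conv\<close>.\<close>

lemma hermite_form_peel_rev:
  assumes "degree p \<le> n" "\<And>k. k \<ge> N \<Longrightarrow> v k = 0"
  shows "hermite_form N (Suc n) ([:-a, 1:] * p) v =
    hermite_form N n p (\<lambda>k. v k - a * v (Suc k)) + (1 - (cmod a)\<^sup>2) * (cmod (cnj_conv n p v 0))\<^sup>2"
proof -
  have 1: "rev_conv n p (\<lambda>k. v k - a * v (Suc k)) k = rev_conv n p v k - a * rev_conv n p v (Suc k)" for k
    using rev_conv_linear_comb[of n p 1 v "- a" "\<lambda>k. v (Suc k)" k] by (simp add: rev_conv_Suc)
  have 2: "cnj_conv n p (\<lambda>k. v k - a * v (Suc k)) k = cnj_conv n p v k - a * cnj_conv n p v (Suc k)" for k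
    using cnj_conv_linear_comb[of n p 1 v "- a" "\<lambda>k. v (Suc k)" k] by (simp add: cnj_conv_Suc)
  have "cnj_conv n p v N = 0"
    using assms(2) by (intro cnj_conv_eq_0[of N]) auto
  then show ?thesis
    using sum_reflection_identity[of "cnj_conv n p v" N a]
    unfolding hermite_form_def 1 2 rev_conv_linear_mult[OF assms(1)] cnj_conv_linear_mult[OF assms(1)]
    by simp
qed

lemma cmod_parallelogram: "(cmod (x + y))\<^sup>2 + (cmod (x - y))\<^sup>2 = 2 * (cmod x)\<^sup>2 + 2 * (cmod y)\<^sup>2"
  unfolding cmod_power2 by (simp add: algebra_simps power2_eq_square)

text \<open>This stands in for Cauchy-Schwarz: with nonnegativity it makes the null vectors of the
  form a subspace.\<close>

lemma hermite_form_parallelogram: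
  "hermite_form N n p (\<lambda>k. c * u k + d * v k) + hermite_form N n p (\<lambda>k. c * u k - d * v k) =
   2 * (cmod c)\<^sup>2 * hermite_form N n p u + 2 * (cmod d)\<^sup>2 * hermite_form N n p v"
proof -
  have m: "rev_conv n p (\<lambda>k. c * u k - d * v k) k = c * rev_conv n p u k - d * rev_conv n p v k"
    "cnj_conv n p (\<lambda>k. c * u k - d * v k) k = c * cnj_conv n p u k - d * cnj_conv n p v k" for k
    using rev_conv_linear_comb[of n p c u "-d" v k] cnj_conv_linear_comb[of n p c u "-d" v k] by simp_all
  have "(\<Sum>k<N. (cmod (c * f k + d * g k))\<^sup>2) + (\<Sum>k<N. (cmod (c * f k - d * g k))\<^sup>2) =
     2 * (cmod c)\<^sup>2 * (\<Sum>k<N. (cmod (f k))\<^sup>2) + 2 * (cmod d)\<^sup>2 * (\<Sum>k<N. (cmod (g k))\<^sup>2)" for f g :: "nat \<Rightarrow> complex"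
    by (simp add: sum.distrib[symmetric] cmod_parallelogram sum_distrib_left norm_mult power_mult_distrib mult.assoc)
  from this[of "rev_conv n p u" "rev_conv n p v"] this[of "cnj_conv n p u" "cnj_conv n p v"]
  show ?thesis
    unfolding hermite_form_def m rev_conv_linear_comb cnj_conv_linear_comb by (simp add: algebra_simps)
qed

lemma poly_obtain_linear_factor:
  fixes p :: "complex poly"
  assumes "degree p = Suc n" "lead_coeff p = 1"
  obtains a q where "p = [:-a, 1:] * q" "degree q = n" "lead_coeff q = 1"
proof -
  obtain a where a: "poly p a = 0"
    using fundamental_theorem_of_algebra[of p] constant_degree[of p] assms by auto
  then obtain q where q: "p = [:-a, 1:] * q"
    using poly_eq_0_iff_dvd by (metis dvd_def)
  moreover from q assms have "q \<noteq> 0" by auto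
  then have "degree p = Suc (degree q)"
    unfolding q by (subst degree_mult_eq) auto
  moreover have "lead_coeff q = 1"
    using assms(2) unfolding q lead_coeff_mult by simp
  ultimately show ?thesis
    using that assms by simp
qed

text \<open>Each root split off contributes a nonnegative square; for the remaining constant 1 the
  two sums cancel.\<close>

lemma hermite_form_nonneg:
  assumes "degree p = n" "\<And>a. poly p a = 0 \<Longrightarrow> cmod a < 1" "lead_coeff p = 1"
    and "\<And>k. k \<ge> N \<Longrightarrow> v k = 0"
  shows "hermite_form N n p v \<ge> 0"
  using assms
proof (induction n arbitrary: p v)
  case 0
  then have "coeff p 0 = 1"
    by simp
  then show ?case
    by (simp add: hermite_form_def rev_conv_def cnj_conv_def)
next
  case (Suc n)
  obtain a q where q: "p = [:-a, 1:] * q" "degree q = n" "lead_coeff q = 1"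
    using poly_obtain_linear_factor[OF Suc.prems(1,3)] .
  then have pa: "poly p a = 0"
    by simp
  have "hermite_form N n q (\<lambda>k. v (Suc k) - cnj a * v k) \<ge> 0"
    using q Suc.prems(2,4) by (intro Suc.IH) auto
  moreover have "cmod a < 1"
    using pa Suc.prems(2) by blast
  then have "1 - (cmod a)\<^sup>2 \<ge> 0"
    by (simp add: power_le_one)
  ultimately show ?case
    using hermite_form_peel_cnj[of q n N v a] q Suc.prems(4) by simp
qed

lemma hermite_form_eq_0_linear_comb:
  assumes "degree p = n" "\<And>a. poly p a = 0 \<Longrightarrow> cmod a < 1" "lead_coeff p = 1"
    and "\<And>k. k \<ge> N \<Longrightarrow> u k = 0" "\<And>k. k \<ge> N \<Longrightarrow> v k = 0"
    and "hermite_form N n p u = 0" "hermite_form N n p v = 0"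
  shows "hermite_form N n p (\<lambda>k. c * u k + d * v k) = 0"
proof -
  have "hermite_form N n p (\<lambda>k. c * u k + d * v k) \<ge> 0" "hermite_form N n p (\<lambda>k. c * u k - d * v k) \<ge> 0"
    using assms by (auto intro!: hermite_form_nonneg)
  then show ?thesis
    using hermite_form_parallelogram[of N n p c u d v] assms by simp
qed

text \<open>
  If the form of \<open>(X - a) q\<close> vanishes at \<open>v\<close>, then that of \<open>q\<close> vanishes at two independent combinations
  of \<open>v\<close> and its shift, hence at the shift itself, which is shorter by one.
\<close>
lemma hermite_form_definite:
  assumes "degree p = n" "\<And>a. poly p a = 0 \<Longrightarrow> cmod a < 1" "lead_coeff p = 1"
    and "\<And>k. k \<ge> n \<Longrightarrow> v k = 0" "n \<le> N" and "hermite_form N n p v = 0"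
  shows "v k = 0"
  using assms
proof (induction n arbitrary: p v k)
  case 0
  then show ?case by simp
next
  case (Suc n)
  obtain a q where q: "p = [:-a, 1:] * q" "degree q = n" "lead_coeff q = 1"
    using poly_obtain_linear_factor[OF Suc.prems(1,3)] .
  then have pa: "poly p a = 0"
    by simp
  have a: "cmod a < 1"
    using pa Suc.prems(2) by blast
  then have a1: "1 - (cmod a)\<^sup>2 > 0"
    using power_strict_mono[of "cmod a" 1 2] by simp
  have vN: "v k = 0" if "k \<ge> N" for k
    using that Suc.prems by simp
  have qroots: "\<And>b. poly q b = 0 \<Longrightarrow> cmod b < 1" and qlead: "lead_coeff q = 1"
    using q(1,3) Suc.prems(2) by auto
  let ?f = "\<lambda>k. v k - a * v (Suc k)" and ?g = "\<lambda>k. v (Suc k) - cnj a * v k"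
  have nonneg: "hermite_form N n q ?f \<ge> 0" "hermite_form N n q ?g \<ge> 0"
    using qroots qlead q(2) vN by (auto intro!: hermite_form_nonneg)
  have e1: "hermite_form N n q ?g + (1 - (cmod a)\<^sup>2) * (cmod (rev_conv n q v 0))\<^sup>2 = 0"
    using hermite_form_peel_cnj[of q n N v a] q vN Suc.prems(4,6) by simp
  have e2: "hermite_form N n q ?f + (1 - (cmod a)\<^sup>2) * (cmod (cnj_conv n q v 0))\<^sup>2 = 0"
    using hermite_form_peel_rev[of q n N v a] q vN Suc.prems(4,6) by simp
  have "(1 - (cmod a)\<^sup>2) * (cmod (rev_conv n q v 0))\<^sup>2 \<ge> 0" "(1 - (cmod a)\<^sup>2) * (cmod (cnj_conv n q v 0))\<^sup>2 \<ge> 0"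
    using a1 by simp_all
  then have fg: "hermite_form N n q ?f = 0" "hermite_form N n q ?g = 0"
    and r0: "(1 - (cmod a)\<^sup>2) * (cmod (rev_conv n q v 0))\<^sup>2 = 0"
    using nonneg e1 e2 by linarith+
  have comb: "hermite_form N n q (\<lambda>k. c * ?f k + d * ?g k) = 0" for c d
    using qroots qlead q(2) vN fg by (intro hermite_form_eq_0_linear_comb) auto
  define e where "e = 1 - a * cnj a"
  have e0: "e \<noteq> 0"
    using a1 unfolding e_def complex_norm_square[symmetric]
    by (metis cancel_comm_monoid_add_class.diff_cancel eq_iff_diff_eq_0 less_irrefl of_real_1 of_real_eq_iff)
  \<comment> \<open>The passage from \<open>v\<close> and its shift to \<open>?f\<close> and
    \<open>?g\<close> has determinant \<open>e\<close>, so both can be recovered up to this nonzero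
    factor.\<close>
  have eS: "cnj a * ?f k + 1 * ?g k = e * v (Suc k)" and e: "1 * ?f k + a * ?g k = e * v k" for k
    by (simp_all add: e_def algebra_simps)
  have S0: "v (Suc k) = 0" for k
  proof -
    \<comment> \<open>The shift of \<open>v\<close> vanishes from \<open>n\<close> on, as the
      induction hypothesis for \<open>q\<close> demands; the summation length \<open>N\<close> stays
      the same.\<close>
    have "e * v (Suc k) = 0"
      by (rule Suc.IH[of q "\<lambda>k. e * v (Suc k)"])
        (use comb[of "cnj a" 1, unfolded eS] qroots qlead q(2) Suc.prems(4,5) in auto)
    then show ?thesis using e0 by simp
  qed
  \<comment> \<open>For \<open>n = 0\<close> the factor \<open>q\<close> is 1 and \<open>r0\<close>
    contains |v 0|^2. Otherwise every index \<open>k >= n\<close> is a successor, so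
    \<open>v\<close> itself is now short enough for the induction hypothesis.\<close>
  have "v 0 = 0"
  proof (cases n)
    case 0
    then show ?thesis
      using r0 a1 qlead q(2) by (simp add: rev_conv_def)
  next
    case (Suc m)
    have "e * v k = 0" if "k \<ge> n" for k
      using that S0[of "k - 1"] Suc by simp
    then have "e * v 0 = 0"
      by (rule Suc.IH[of q "\<lambda>k. e * v k" 0, rotated 3])
        (use comb[of 1 a, unfolded e] qroots qlead q(2) Suc.prems(4,5) in auto)
    then show ?thesis using e0 by simp
  qed
  with S0 show ?case
    by (cases k) auto
qed

text \<open>The test vector for necessity. Powers of \<open>cnj a\<close> are an eigenvector of the
  shift up to truncation, so (S - cnj a) v lives at the index \<open>n\<close> alone. There the form
  of \<open>q\<close> vanishes: both sums run over the same squared coefficients, in opposite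
  orders. Only a square with the sign of 1 - |a|^2 is left.\<close>

lemma hermite_form_geometric:
  assumes "degree q = n"
  shows "hermite_form (Suc n) (Suc n) ([:-a, 1:] * q) (\<lambda>k. if k \<le> n then cnj a ^ k else 0) =
    (1 - (cmod a)\<^sup>2) * (cmod (rev_conv n q (\<lambda>k. if k \<le> n then cnj a ^ k else 0) 0))\<^sup>2"
proof -
  let ?v = "\<lambda>k. if k \<le> n then cnj a ^ k else 0"
  let ?w = "\<lambda>k. ?v (Suc k) - cnj a * ?v k"
  let ?c = "- (cnj a ^ Suc n)"
  have w: "?w = (\<lambda>k. if k = n then ?c else 0)"
    by (auto simp: fun_eq_iff)
  have r: "rev_conv n q (\<lambda>k. if k = n then ?c else 0) k = coeff q k * ?c" if "k \<le> n" for k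
  proof -
    have "rev_conv n q (\<lambda>k. if k = n then ?c else 0) k = (\<Sum>l\<le>n. if l = n - k then coeff q (n - l) * ?c else 0)"
      unfolding rev_conv_def using that by (intro sum.cong) auto
    then show ?thesis using that by (simp del: power_Suc)
  qed
  have c: "cnj_conv n q (\<lambda>k. if k = n then ?c else 0) k = cnj (coeff q (n - k)) * ?c" if "k \<le> n" for k
  proof -
    have "cnj_conv n q (\<lambda>k. if k = n then ?c else 0) k = (\<Sum>l\<le>n. if l = n - k then cnj (coeff q l) * ?c else 0)"
      unfolding cnj_conv_def using that by (intro sum.cong) auto
    then show ?thesis by (simp del: power_Suc)
  qed
  have "(\<Sum>k<Suc n. (cmod (cnj (coeff q (n - k)) * ?c))\<^sup>2) = (\<Sum>k<Suc n. (cmod (cnj (coeff q k) * ?c))\<^sup>2)"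
    using sum.nat_diff_reindex[of "\<lambda>k. (cmod (cnj (coeff q k) * ?c))\<^sup>2" "Suc n"] by simp
  then have "hermite_form (Suc n) n q ?w = 0"
    unfolding w hermite_form_def using r c by (simp add: norm_mult)
  then show ?thesis
    using hermite_form_peel_cnj[of q n "Suc n" ?v a] assms by simp
qed

section \<open>The Hermite matrix and its quadratic form\<close>

lemma cscalar_prod_adjoint:
  fixes M :: "complex Matrix.mat"
  assumes "M \<in> carrier_mat n n" "u \<in> carrier_vec n" "v \<in> carrier_vec n"
  shows "(map_mat cnj (transpose_mat M) *\<^sub>v u) \<bullet>c v = u \<bullet>c (M *\<^sub>v v)"
proof -
  have "(map_mat cnj (transpose_mat M) *\<^sub>v u) \<bullet>c v =
      (\<Sum>i<n. \<Sum>j<n. cnj (M $$ (j, i)) * vec_index u j * cnj (vec_index v i))"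
    using assms by (simp add: scalar_prod_def row_def sum_distrib_right lessThan_atLeast0)
  also have "\<dots> = (\<Sum>j<n. \<Sum>i<n. cnj (M $$ (j, i)) * vec_index u j * cnj (vec_index v i))"
    by (rule sum.swap)
  also have "\<dots> = u \<bullet>c (M *\<^sub>v v)"
    using assms by (simp add: scalar_prod_def row_def sum_distrib_left lessThan_atLeast0 mult_ac)
  finally show ?thesis .
qed

lemma cscalar_prod_self:
  fixes v :: "complex Matrix.vec"
  assumes "v \<in> carrier_vec n"
  shows "v \<bullet>c v = of_real (\<Sum>i<n. (cmod (vec_index v i))\<^sup>2)"
  using assms by (simp add: scalar_prod_def complex_norm_square lessThan_atLeast0 del: of_real_power)

lemma upper_toeplitz_carrier [simp]: "upper_toeplitz n r \<in> carrier_mat n n"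
  by (simp add: upper_toeplitz_def)

lemma upper_toeplitz_mult_vec:
  fixes r :: "nat \<Rightarrow> 'a::semiring_0"
  assumes "v \<in> carrier_vec n" "i < n"
  shows "vec_index (upper_toeplitz n r *\<^sub>v v) i =
    (\<Sum>l\<le>n. r l * (if i + l < n then vec_index v (i + l) else 0))"
proof -
  have "vec_index (upper_toeplitz n r *\<^sub>v v) i = (\<Sum>j<n. (if i \<le> j then r (j - i) else 0) * vec_index v j)"
    using assms by (simp add: upper_toeplitz_def scalar_prod_def lessThan_atLeast0)
  also have "\<dots> = (\<Sum>j\<in>{i..<n}. r (j - i) * vec_index v j)"
    by (rule sum.mono_neutral_cong_right) auto
  also have "\<dots> = (\<Sum>l\<in>{..<n - i}. r l * vec_index v (i + l))"
    by (rule sum.reindex_bij_witness[of _ "\<lambda>l. i + l" "\<lambda>j. j - i"]) auto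
  also have "\<dots> = (\<Sum>l\<le>n. r l * (if i + l < n then vec_index v (i + l) else 0))"
    by (rule sum.mono_neutral_cong_left) auto
  finally show ?thesis .
qed

lemma hermite_mat_hermitian: "map_mat cnj (transpose_mat (hermite_mat n p)) = hermite_mat n p"
  by (rule eq_matI)
    (auto simp: hermite_mat_def Let_def upper_toeplitz_def scalar_prod_def mult_ac intro!: sum.cong
      arg_cong2[of _ _ _ _ minus])

lemma hermite_mat_form:
  assumes v: "v \<in> carrier_vec n"
  shows "Re ((hermite_mat n p *\<^sub>v v) \<bullet>c v) =
    hermite_form n n p (\<lambda>k. if k < n then vec_index v k else 0)"
proof -
  define S1 where "S1 = upper_toeplitz n (\<lambda>l. coeff p (n - l))"
  \<comment> \<open>Conjugated coefficients are used so that the subtracted product, too, is an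
    adjoint times the matrix itself; both parts of the form then become squared norms.\<close>
  define S2 where "S2 = upper_toeplitz n (\<lambda>l. cnj (coeff p l))"
  have c: "S1 \<in> carrier_mat n n" "S2 \<in> carrier_mat n n"
    by (simp_all add: S1_def S2_def)
  have S2: "map_mat cnj (upper_toeplitz n (\<lambda>l. coeff p l)) = S2"
    "transpose_mat (upper_toeplitz n (\<lambda>l. coeff p l)) = map_mat cnj (transpose_mat S2)"
    by (auto simp: S2_def upper_toeplitz_def intro!: eq_matI)
  have "(hermite_mat n p *\<^sub>v v) \<bullet>c v =
      (map_mat cnj (transpose_mat S1) *\<^sub>v (S1 *\<^sub>v v)) \<bullet>c v - (map_mat cnj (transpose_mat S2) *\<^sub>v (S2 *\<^sub>v v)) \<bullet>c v"
    unfolding hermite_mat_def Let_def S1_def[symmetric] S2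
    using c v
    by (subst minus_mult_distrib_mat_vec[of _ n n], simp_all)
      (subst minus_scalar_prod_distrib[of _ n], simp_all add: assoc_mult_mat_vec[of _ n n _ n])
  also have "\<dots> = (S1 *\<^sub>v v) \<bullet>c (S1 *\<^sub>v v) - (S2 *\<^sub>v v) \<bullet>c (S2 *\<^sub>v v)"
    using c v by (simp add: cscalar_prod_adjoint)
  also have "\<dots> = of_real (\<Sum>i<n. (cmod (vec_index (S1 *\<^sub>v v) i))\<^sup>2) - of_real (\<Sum>i<n. (cmod (vec_index (S2 *\<^sub>v v) i))\<^sup>2)"
    using c v cscalar_prod_self[of "S1 *\<^sub>v v" n] cscalar_prod_self[of "S2 *\<^sub>v v" n] by simp
  also have "\<dots> = of_real (hermite_form n n p (\<lambda>k. if k < n then vec_index v k else 0))"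
    unfolding hermite_form_def rev_conv_def cnj_conv_def of_real_diff[symmetric] S1_def S2_def
    using v by (simp add: upper_toeplitz_mult_vec)
  finally show ?thesis
    by simp
qed

text \<open>A root a makes the form at the powers of \<open>cnj a\<close> equal to 1 - |a|^2 times a
  square, so positivity forces |a| < 1. The converse combines nonnegativity with
  definiteness.\<close>

theorem schur_cohn:
  assumes "degree p = n" "lead_coeff p = 1"
  shows "positive_definite_mat (hermite_mat n p) \<longleftrightarrow> (\<forall>a. poly p a = 0 \<longrightarrow> cmod a < 1)"
proof
  have dim: "dim_row (hermite_mat n p) = n"
    by (simp add: hermite_mat_def Let_def upper_toeplitz_def)
  {
    assume pd: "positive_definite_mat (hermite_mat n p)"
    show "\<forall>a. poly p a = 0 \<longrightarrow> cmod a < 1"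
    proof (intro allI impI)
      fix a assume "poly p a = 0"
      then obtain q where q: "p = [:-a, 1:] * q"
        using poly_eq_0_iff_dvd by (metis dvd_def)
      with assms have "q \<noteq> 0" by auto
      then have n: "n = Suc (degree q)"
        unfolding assms(1)[symmetric] q by (subst degree_mult_eq) auto
      define v where "v = Matrix.vec n (\<lambda>k. cnj a ^ k)"
      have "v \<in> carrier_vec n" "vec_index v 0 = 1"
        using n by (simp_all add: v_def)
      moreover from this n have "v \<noteq> 0\<^sub>v n"
        by auto
      ultimately have "Re ((hermite_mat n p *\<^sub>v v) \<bullet>c v) > 0"
        using pd by (simp add: positive_definite_mat_def dim)
      also have "Re ((hermite_mat n p *\<^sub>v v) \<bullet>c v) =
          hermite_form n n p (\<lambda>k. if k < n then vec_index v k else 0)"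
        by (rule hermite_mat_form) (simp add: v_def)
      also have "(\<lambda>k. if k < n then vec_index v k else 0) = (\<lambda>k. if k \<le> degree q then cnj a ^ k else 0)"
        by (auto simp: v_def n)
      finally have "(1 - (cmod a)\<^sup>2) * (cmod (rev_conv (degree q) q (\<lambda>k. if k \<le> degree q then cnj a ^ k else 0) 0))\<^sup>2 > 0"
        using hermite_form_geometric[OF refl, of q a] by (simp add: n q)
      then have "1 - (cmod a)\<^sup>2 > 0"
        by (auto simp: zero_less_mult_iff)
      then show "cmod a < 1"
        using power2_less_imp_less[of "cmod a" 1] by simp
    qed
  next
    assume roots: "\<forall>a. poly p a = 0 \<longrightarrow> cmod a < 1"
    have "Re ((hermite_mat n p *\<^sub>v v) \<bullet>c v) > 0" if v: "v \<in> carrier_vec n" "v \<noteq> 0\<^sub>v n" for v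
    proof (rule ccontr)
      let ?w = "\<lambda>k. if k < n then vec_index v k else 0"
      assume "\<not> Re ((hermite_mat n p *\<^sub>v v) \<bullet>c v) > 0"
      then have "hermite_form n n p ?w = 0"
        using hermite_form_nonneg[of p n n ?w] assms roots hermite_mat_form[OF v(1), of p] by simp
      then have w: "?w k = 0" for k
        by (rule hermite_form_definite[of p n ?w n, rotated 5]) (use assms roots in auto)
      then have "v = 0\<^sub>v n"
        using v w by (intro eq_vecI) (metis carrier_vecD index_zero_vec, simp)
      with v show False by simp
    qed
    then show "positive_definite_mat (hermite_mat n p)"
      by (simp add: positive_definite_mat_def dim hermite_mat_hermitian)
  }
qed

section \<open>The characteristic polynomial\<close>

lemma continuous_on_det_one_add_scaled:
  fixes A :: "complex ^ 'n ^ 'n"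
  shows "continuous_on UNIV (\<lambda>w. Determinants.det (Finite_Cartesian_Product.mat 1 + (\<chi> i j. w * A $ i $ j)))"
  unfolding Determinants.det_def
  by (intro continuous_intros)

lemma det_eq_0_iff_kernel:
  fixes A :: "'a::field ^ 'n ^ 'n"
  shows "Determinants.det A = 0 \<longleftrightarrow> (\<exists>v. v \<noteq> 0 \<and> A *v v = 0)"
  using invertible_det_nz[of A] matrix_left_invertible_ker[of A] invertible_left_inverse[of A] by auto

lemma degree_sum_le_bound: "(\<And>i. i \<in> S \<Longrightarrow> degree (f i) \<le> n) \<Longrightarrow> degree (sum f S) \<le> n"
  by (induction S rule: infinite_finite_induct) (auto intro: degree_add_le)

text \<open>The matrix A(z). At \<open>z k = exp (- \<mu> * \<tau> k)\<close>, the identity plus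
  this matrix is the characteristic matrix of the delay equation at the exponent \<mu>.\<close>

definition delay_symbol :: "('m::finite \<Rightarrow> real ^ 'n ^ 'n) \<Rightarrow> ('m \<Rightarrow> complex) \<Rightarrow> complex ^ 'n ^ 'n" where
  "delay_symbol H z = (\<chi> i j. \<Sum>k\<in>UNIV. z k * complex_of_real (H k $ i $ j))"

lemma poly_char_poly_at_symbol:
  "poly (char_poly_at H z) z0 = Determinants.det (Finite_Cartesian_Product.mat z0 + delay_symbol H z)"
  unfolding poly_char_poly_at delay_symbol_def ..

lemma degree_char_poly_at_le:
  fixes H :: "'m::finite \<Rightarrow> real ^ 'n ^ 'n"
  shows "degree (char_poly_at H z) \<le> CARD('n)"
proof -
  define M where "M = Finite_Cartesian_Product.mat [:0, 1:] + (\<chi> i j. [:delay_symbol H z $ i $ j:])"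
  have entry: "degree (M $ i $ j) \<le> 1" for i j
    unfolding M_def by (auto simp: Finite_Cartesian_Product.mat_def intro!: degree_add_le)
  have "degree (of_int (sign p) * (\<Prod>i\<in>UNIV. M $ i $ p i)) \<le> CARD('n)" for p
  proof -
    have "degree (\<Prod>i\<in>UNIV. M $ i $ p i) \<le> (\<Sum>i\<in>UNIV. degree (M $ i $ p i))"
      using degree_prod_sum_le[of UNIV "\<lambda>i. M $ i $ p i"] by (simp add: o_def)
    also have "\<dots> \<le> (\<Sum>i\<in>(UNIV::'n set). 1)"
      by (intro sum_mono entry)
    finally show ?thesis
      by (auto simp: sign_def)
  qed
  then have "degree (Determinants.det M) \<le> CARD('n)"
    unfolding Determinants.det_def by (intro degree_sum_le_bound)
  then show ?thesis
    unfolding char_poly_at_def M_def delay_symbol_def by simp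
qed

text \<open>For w nonzero, det (1 + w A(z)) equals w^n p(1/w), the polynomial with reversed
  coefficients. Both sides are continuous, and at w = 0 they give 1 and the coefficient of degree
  n.\<close>

lemma coeff_char_poly_at:
  fixes H :: "'m::finite \<Rightarrow> real ^ 'n ^ 'n"
  shows "coeff (char_poly_at H z) CARD('n) = 1"
proof -
  let ?n = "CARD('n)" and ?p = "char_poly_at H z" and ?A = "delay_symbol H z"
  let ?f = "\<lambda>w. Determinants.det (Finite_Cartesian_Product.mat 1 + (\<chi> i j. w * ?A $ i $ j))"
  let ?g = "\<lambda>w. \<Sum>l\<le>?n. coeff ?p l * w ^ (?n - l)"
  have eq: "?f w = ?g w" if "w \<noteq> 0" for w
  proof -
    have "Finite_Cartesian_Product.mat 1 + (\<chi> i j. w * ?A $ i $ j) =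
        (\<chi> i. w *s (Finite_Cartesian_Product.mat (1 / w) + ?A) $ i)"
      using that by (auto simp: Finite_Cartesian_Product.vec_eq_iff Finite_Cartesian_Product.mat_def algebra_simps)
    then have "?f w = w ^ ?n * poly ?p (1 / w)"
      using det_rows_mul[of "\<lambda>_. w" "\<lambda>i. (Finite_Cartesian_Product.mat (1 / w) + ?A) $ i"]
      by (simp only: poly_char_poly_at_symbol vec_nth_inverse vec_lambda_eta prod_constant)
    also have "\<dots> = w ^ ?n * (\<Sum>l\<le>?n. coeff ?p l * (1 / w) ^ l)"
      using degree_char_poly_at_le[of H z]
      by (subst poly_altdef) (auto intro!: sum.mono_neutral_left dest: le_degree)
    also have "\<dots> = ?g w"
      unfolding sum_distrib_left using that
      by (intro sum.cong) (auto simp: power_diff field_simps)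
    finally show ?thesis .
  qed
  have f: "(?f \<longlongrightarrow> ?f 0) (at 0)"
    using continuous_on_det_one_add_scaled[of ?A] unfolding continuous_on_def by blast
  have g: "(?g \<longlongrightarrow> ?g 0) (at 0)"
    by (intro tendsto_intros)
  have ev: "eventually (\<lambda>w. ?f w = ?g w) (at 0)"
    using eq by (simp add: eventually_at_filter)
  have "?f 0 = ?g 0"
    using Lim_transform_eventually[OF f ev] g by (rule tendsto_unique[OF at_neq_bot])
  moreover have "?g 0 = (\<Sum>l\<in>{?n}. coeff ?p l)"
    by (rule sum.mono_neutral_cong_right) auto
  moreover have "?f 0 = 1"
    by (simp flip: Finite_Cartesian_Product.zero_vec_def)
  ultimately show ?thesis by simp
qed

lemma degree_char_poly_at:
  fixes H :: "'m::finite \<Rightarrow> real ^ 'n ^ 'n"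
  shows "degree (char_poly_at H z) = CARD('n)"
  using degree_char_poly_at_le[of H z] coeff_char_poly_at[of H z] le_degree[of "char_poly_at H z" "CARD('n)"]
  by simp

corollary hermite_positive_iff_roots:
  fixes H :: "'m::finite \<Rightarrow> real ^ 'n ^ 'n"
  shows "positive_definite_mat (hermite_mat CARD('n) (char_poly_at H z)) \<longleftrightarrow>
    (\<forall>a. Determinants.det (Finite_Cartesian_Product.mat a + delay_symbol H z) = 0 \<longrightarrow> cmod a < 1)"
  using schur_cohn[of "char_poly_at H z" "CARD('n)"] degree_char_poly_at[of H z] coeff_char_poly_at[of H z]
  by (simp add: poly_char_poly_at_symbol)

section \<open>Roots outside the unit disc\<close>

text \<open>The complex factor \<open>c\<close> selects a real solution from the complex exponential
  one: \<open>c = 1\<close> gives its real part and \<open>c = - \<i>\<close> its imaginary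
  part.\<close>

definition mode :: "complex \<Rightarrow> complex ^ 'n \<Rightarrow> complex \<Rightarrow> real \<Rightarrow> real ^ 'n" where
  "mode \<mu> v c t = (\<chi> i. Re (c * exp (\<mu> * of_real t) * v $ i))"

text \<open>A delay multiplies the exponential by \<open>exp (- \<mu> * \<tau> k)\<close>, so the
  complex residual is a scalar times the characteristic matrix applied to \<open>v\<close>. As
  \<open>H\<close> is real, real parts can be taken.\<close>

lemma mode_solution:
  fixes H :: "'m::finite \<Rightarrow> real ^ 'n ^ 'n"
  assumes "(Finite_Cartesian_Product.mat 1 + delay_symbol H (\<lambda>k. exp (- \<mu> * of_real (\<tau> k)))) *v v = 0"
  shows "dde_solution H \<tau> (mode \<mu> v c)"
  unfolding dde_solution_def
proof (intro conjI allI impI)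
  show "continuous_on {- max_delay \<tau>..} (mode \<mu> v c)"
    unfolding mode_def by (intro continuous_intros)
  fix t :: real
  have "(mode \<mu> v c t + (\<Sum>k\<in>UNIV. H k *v mode \<mu> v c (t - \<tau> k))) $ i = 0" for i
  proof -
    have "((Finite_Cartesian_Product.mat 1 + delay_symbol H (\<lambda>k. exp (- \<mu> * of_real (\<tau> k)))) *v v) $ i = 0"
      using assms by simp
    moreover have "(delay_symbol H w *v v) $ i = (\<Sum>j\<in>UNIV. \<Sum>k\<in>UNIV. w k * of_real (H k $ i $ j) * v $ j)" for w
      by (simp add: matrix_vector_mult_def delay_symbol_def sum_distrib_right)
    ultimately have 0: "v $ i + (\<Sum>j\<in>UNIV. \<Sum>k\<in>UNIV. exp (- \<mu> * of_real (\<tau> k)) * of_real (H k $ i $ j) * v $ j) = 0"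
      by (simp add: matrix_vector_mult_add_rdistrib)
    have e: "exp (\<mu> * of_real (t - \<tau> k)) = exp (\<mu> * of_real t) * exp (- \<mu> * of_real (\<tau> k))" for k
      by (simp add: exp_add[symmetric] algebra_simps)
    have "(mode \<mu> v c t + (\<Sum>k\<in>UNIV. H k *v mode \<mu> v c (t - \<tau> k))) $ i =
        Re (c * exp (\<mu> * of_real t) * v $ i) +
        (\<Sum>k\<in>UNIV. \<Sum>j\<in>UNIV. H k $ i $ j * Re (c * exp (\<mu> * of_real (t - \<tau> k)) * v $ j))"
      by (simp add: mode_def matrix_vector_mult_def)
    also have "\<dots> = Re (c * exp (\<mu> * of_real t) * v $ i +
        (\<Sum>k\<in>UNIV. \<Sum>j\<in>UNIV. of_real (H k $ i $ j) * (c * exp (\<mu> * of_real (t - \<tau> k)) * v $ j)))"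
      unfolding Re_sum plus_complex.simps Re_complex_of_real by (simp only: scaleR_conv_of_real[symmetric] scaleR_complex.simps)
    also have "(\<Sum>k\<in>UNIV. \<Sum>j\<in>UNIV. of_real (H k $ i $ j) * (c * exp (\<mu> * of_real (t - \<tau> k)) * v $ j)) =
       c * exp (\<mu> * of_real t) * (\<Sum>j\<in>UNIV. \<Sum>k\<in>UNIV. exp (- \<mu> * of_real (\<tau> k)) * of_real (H k $ i $ j) * v $ j)"
      unfolding e sum_distrib_left by (subst sum.swap) (simp add: mult_ac)
    also have "c * exp (\<mu> * of_real t) * v $ i + \<dots> = c * exp (\<mu> * of_real t) *
       (v $ i + (\<Sum>j\<in>UNIV. \<Sum>k\<in>UNIV. exp (- \<mu> * of_real (\<tau> k)) * of_real (H k $ i $ j) * v $ j))"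
      by (simp only: distrib_left)
    finally show ?thesis
      unfolding 0 by simp
  qed
  then show "mode \<mu> v c t + (\<Sum>k\<in>UNIV. H k *v mode \<mu> v c (t - \<tau> k)) = 0"
    unfolding Finite_Cartesian_Product.vec_eq_iff zero_index by blast
qed

lemma exponentially_stable_imp_solution_tendsto_0:
  assumes "exponentially_stable H \<tau>" "dde_solution H \<tau> x"
  shows "(x \<longlongrightarrow> 0) at_top"
proof -
  obtain M \<alpha> where "\<alpha> > 0" and
    le: "\<forall>t\<ge>0. norm (x t) \<le> M * exp (- \<alpha> * t) * (SUP s\<in>{- max_delay \<tau>..0}. norm (x s))"
    using assms unfolding exponentially_stable_def by blast
  have "filterlim (\<lambda>t. \<alpha> * t) at_top at_top"
    using \<open>\<alpha> > 0\<close> by (intro filterlim_tendsto_pos_mult_at_top[OF tendsto_const] filterlim_ident) 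
  then have "filterlim (\<lambda>t. - \<alpha> * t) at_bot at_top"
    by (simp add: filterlim_uminus_at_bot)
  then have "((\<lambda>t. exp (- \<alpha> * t)) \<longlongrightarrow> 0) at_top"
    by (rule filterlim_compose[OF exp_at_bot])
  then have "((\<lambda>t. M * exp (- \<alpha> * t) * (SUP s\<in>{- max_delay \<tau>..0}. norm (x s))) \<longlongrightarrow> M * 0 * (SUP s\<in>{- max_delay \<tau>..0}. norm (x s))) at_top"
    by (intro tendsto_intros)
  then have lim: "((\<lambda>t. M * exp (- \<alpha> * t) * (SUP s\<in>{- max_delay \<tau>..0}. norm (x s))) \<longlongrightarrow> 0) at_top"
    by simp
  show ?thesis
    by (rule Lim_null_comparison[OF _ lim]) (use le in \<open>auto simp: eventually_at_top_linorder\<close>)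
qed

text \<open>Stability would send both real and imaginary part of a nonzero component of
  \<open>exp (\<mu> t) v\<close> to 0, whereas its modulus never drops below the initial one for t
  >= 0.\<close>

lemma not_exponentially_stable_if_kernel:
  fixes H :: "'m::finite \<Rightarrow> real ^ 'n ^ 'n"
  assumes ker: "(Finite_Cartesian_Product.mat 1 + delay_symbol H (\<lambda>k. exp (- \<mu> * of_real (\<tau> k)))) *v v = 0"
    and "v \<noteq> 0" "Re \<mu> \<ge> 0"
  shows "\<not> exponentially_stable H \<tau>"
proof
  assume stable: "exponentially_stable H \<tau>"
  obtain i where i: "v $ i \<noteq> 0"
    using \<open>v \<noteq> 0\<close> by (auto simp: Finite_Cartesian_Product.vec_eq_iff)
  have lim: "((\<lambda>t. Re (c * exp (\<mu> * of_real t) * v $ i)) \<longlongrightarrow> 0) at_top" for c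
    using tendsto_vec_nth[OF exponentially_stable_imp_solution_tendsto_0[OF stable mode_solution[OF ker, of c]], of i]
    by (simp add: mode_def)
  have "((\<lambda>t. exp (\<mu> * of_real t) * v $ i) \<longlongrightarrow> 0) at_top"
    unfolding tendsto_complex_iff using lim[of 1] lim[of "- \<i>"] by simp
  then have "eventually (\<lambda>t::real. cmod (exp (\<mu> * of_real t) * v $ i) < cmod (v $ i)) at_top"
    using i by (auto simp: tendsto_iff dist_norm)
  then obtain b where b: "\<And>t::real. t \<ge> b \<Longrightarrow> cmod (exp (\<mu> * of_real t) * v $ i) < cmod (v $ i)"
    by (auto simp: eventually_at_top_linorder)
  have "1 * cmod (v $ i) \<le> exp (Re \<mu> * max b 0) * cmod (v $ i)"
    using \<open>Re \<mu> \<ge> 0\<close> by (intro mult_right_mono) auto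
  then show False
    using b[of "max b 0"] by (simp add: norm_mult)
qed

lemma det_symbol_scale:
  assumes "a \<noteq> 0"
  shows "Determinants.det (Finite_Cartesian_Product.mat 1 + delay_symbol H (\<lambda>k. z k / a)) = 0 \<longleftrightarrow>
    Determinants.det (Finite_Cartesian_Product.mat a + delay_symbol H z) = 0"
proof -
  have "(Finite_Cartesian_Product.mat a + delay_symbol H z) =
      (\<chi> i. a *s (Finite_Cartesian_Product.mat 1 + delay_symbol H (\<lambda>k. z k / a)) $ i)"
    using assms by (auto simp: Finite_Cartesian_Product.vec_eq_iff Finite_Cartesian_Product.mat_def
        delay_symbol_def algebra_simps sum_distrib_left)
  then show ?thesis
    using assms det_rows_mul[of "\<lambda>_. a" "\<lambda>i. (Finite_Cartesian_Product.mat 1 + delay_symbol H (\<lambda>k. z k / a)) $ i"]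
    by (simp only: vec_lambda_eta prod_constant) simp
qed

lemma unit_complex_eq_exp:
  assumes "cmod c = 1"
  obtains \<theta> :: real where "\<theta> > 0" "exp (- \<i> * of_real \<theta>) = c"
proof
  \<comment> \<open>Two full turns are added to \<open>- Arg c\<close>, because the angle will serve
    as a delay and must be positive.\<close>
  have "exp (- \<i> * of_real (4 * pi - Arg c)) = exp (\<i> * of_real (Arg c) - of_nat 2 * (of_real (2 * pi) * \<i>))"
    by (simp add: algebra_simps)
  also have "\<dots> = exp (\<i> * of_real (Arg c))"
    unfolding exp_diff exp_of_nat_mult by simp
  also have "\<dots> = c"
    using assms Arg_eq[of c] by (metis mult_1 norm_zero of_real_1 zero_neq_one)
  finally show "exp (- \<i> * of_real (4 * pi - Arg c)) = c" .
  show "4 * pi - Arg c > 0"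
    using Arg_le_pi[of c] pi_gt_zero by linarith
qed

text \<open>All \<open>z k / a\<close> are unimodular, so positive delays with
  \<open>exp (- \<i> * \<tau> k) = z k / a\<close> exist, and \<i> becomes a characteristic
  root.\<close>

lemma strongly_stable_root_not_unit:
  fixes H :: "'m::finite \<Rightarrow> real ^ 'n ^ 'n"
  assumes "strongly_stable H" "\<And>k. cmod (z k) = 1" "cmod a = 1"
  shows "Determinants.det (Finite_Cartesian_Product.mat a + delay_symbol H z) \<noteq> 0"
proof
  assume "Determinants.det (Finite_Cartesian_Product.mat a + delay_symbol H z) = 0"
  then obtain v where v: "v \<noteq> 0" "(Finite_Cartesian_Product.mat 1 + delay_symbol H (\<lambda>k. z k / a)) *v v = 0"
    using assms det_symbol_scale[of a H z] by (force simp: det_eq_0_iff_kernel)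
  have "\<exists>\<theta>::real. \<theta> > 0 \<and> exp (- \<i> * of_real \<theta>) = z k / a" for k
    using unit_complex_eq_exp[of "z k / a"] assms by (metis norm_divide divide_self_if zero_neq_one)
  then obtain \<tau> :: "'m \<Rightarrow> real" where \<tau>: "\<And>k. \<tau> k > 0" "\<And>k. exp (- \<i> * of_real (\<tau> k)) = z k / a"
    by metis
  have "\<not> exponentially_stable H \<tau>"
    using v \<tau>(2) by (intro not_exponentially_stable_if_kernel[of H \<i> \<tau> v]) simp_all
  then show False
    using assms(1) \<tau>(1) by (simp add: strongly_stable_def)
qed

lemma continuous_on_det_symbol [continuous_intros]:
  fixes H :: "'m::finite \<Rightarrow> real ^ 'n ^ 'n"
  assumes "\<And>k. continuous_on S (\<lambda>x. f x k)"
  shows "continuous_on S (\<lambda>x. Determinants.det (Finite_Cartesian_Product.mat 1 + delay_symbol H (f x)))"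
  unfolding Determinants.det_def delay_symbol_def using assms by (auto intro!: continuous_intros)

lemma holomorphic_on_det_symbol:
  fixes H :: "'m::finite \<Rightarrow> real ^ 'n ^ 'n"
  assumes "\<And>k. (\<lambda>x. f x k) holomorphic_on S"
  shows "(\<lambda>x. Determinants.det (Finite_Cartesian_Product.mat 1 + delay_symbol H (f x))) holomorphic_on S"
  unfolding Determinants.det_def delay_symbol_def using assms by (auto intro!: holomorphic_intros)

text \<open>
  Nearly equal delays \<open>1 + \<epsilon> k / N\<close> together with the large frequency \<open>2 * pi * N\<close> realise the
  prescribed phases \<open>z k\<close> while all moduli \<open>exp (- Re s * \<tau> k)\<close> stay close to \<open>exp (- Re s)\<close>.
\<close>
lemma strongly_stable_root_not_outside:
  fixes H :: "'m::finite \<Rightarrow> real ^ 'n ^ 'n"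
  assumes "strongly_stable H" "\<And>k. cmod (z k) = 1" "cmod a > 1"
  shows "Determinants.det (Finite_Cartesian_Product.mat a + delay_symbol H z) \<noteq> 0"
proof -
  let ?det = "\<lambda>w. Determinants.det (Finite_Cartesian_Product.mat 1 + delay_symbol H w)"
  have "\<exists>\<theta>::real. \<theta> > 0 \<and> exp (- \<i> * of_real \<theta>) = z k" for k
    using unit_complex_eq_exp[of "z k"] assms(2) by metis
  then obtain \<theta> :: "'m \<Rightarrow> real" where \<theta>: "\<And>k. \<theta> k > 0" "\<And>k. exp (- \<i> * of_real (\<theta> k)) = z k"
    by metis
  define \<tau> where "\<tau> u k = 1 + u * (\<theta> k / (2 * pi))" for u k
  define F where "F u s = ?det (\<lambda>k. z k * exp (- s * of_real (\<tau> u k)))" for u s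
  let ?u = "\<lambda>N. 1 / real (Suc N)"
  let ?S = "{s. 0 < Re s}"
  have "a \<noteq> 0"
    using assms(3) by auto
  then have Ln: "Ln a \<in> ?S"
    using assms(3) by simp
  have nz: "F (?u N) s \<noteq> 0" if "s \<in> ?S" for N s
  proof
    assume F0: "F (?u N) s = 0"
    \<comment> \<open>The added frequency times the delay is a whole number of turns plus
      \<open>\<theta> k\<close>, which yields exactly the factor \<open>z k\<close>. A zero of
      \<open>F (?u N)\<close> is thus a characteristic root in the right half-plane.\<close>
    define \<mu> where "\<mu> = s + of_real (2 * pi * real (Suc N)) * \<i>"
    have "exp (- \<mu> * of_real (\<tau> (?u N) k)) = z k * exp (- s * of_real (\<tau> (?u N) k))" for k
    proof -
      have "(2 * pi * real (Suc N)) * \<tau> (?u N) k = 2 * pi * real (Suc N) + \<theta> k"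
        unfolding \<tau>_def by (simp add: distrib_left del: of_nat_Suc)
      then have "\<i> * (of_real (2 * pi * real (Suc N)) * of_real (\<tau> (?u N) k)) =
          \<i> * of_real (2 * pi * real (Suc N) + \<theta> k)"
        by (metis of_real_mult)
      then have "- \<mu> * of_real (\<tau> (?u N) k) =
          - s * of_real (\<tau> (?u N) k) + (- \<i> * of_real (\<theta> k) - of_nat (Suc N) * (of_real (2 * pi) * \<i>))"
        unfolding \<mu>_def by (simp add: algebra_simps)
      then have "exp (- \<mu> * of_real (\<tau> (?u N) k)) =
          exp (- s * of_real (\<tau> (?u N) k)) * (exp (- \<i> * of_real (\<theta> k)) / exp (of_real (2 * pi) * \<i>) ^ Suc N)"
        by (simp only: exp_add exp_diff exp_of_nat_mult)
      then show ?thesis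
        unfolding \<theta>(2) by simp
    qed
    then obtain v where "v \<noteq> 0"
      "(Finite_Cartesian_Product.mat 1 + delay_symbol H (\<lambda>k. exp (- \<mu> * of_real (\<tau> (?u N) k)))) *v v = 0"
      using F0 by (auto simp: F_def det_eq_0_iff_kernel)
    moreover have "Re \<mu> \<ge> 0"
      using that by (simp add: \<mu>_def)
    ultimately have "\<not> exponentially_stable H (\<tau> (?u N))"
      by (intro not_exponentially_stable_if_kernel)
    moreover have "\<tau> (?u N) k > 0" for k
      unfolding \<tau>_def using \<theta>(1)[of k] by (intro add_pos_nonneg) simp_all
    ultimately show False
      using assms(1) by (simp add: strongly_stable_def)
  qed
  have F0: "F 0 s = ?det (\<lambda>k. z k * exp (- s))" for s
    by (simp add: F_def \<tau>_def)
  \<comment> \<open>As \<open>exp (- Ln a)\<close> is \<open>1 / a\<close>, this is the claim up to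
    scaling. Hurwitz' theorem transfers the absence of zeros from \<open>F (?u N)\<close> to a
    nonconstant limit; a constant limit is treated first, by evaluating it far to the right, where
    the determinant is close to 1.\<close>
  have "F 0 (Ln a) \<noteq> 0"
  proof (cases "F 0 constant_on ?S")
    case True
    have "isCont (\<lambda>w. ?det (\<lambda>k. z k * w)) 0"
    proof -
      have "continuous_on UNIV (\<lambda>w. ?det (\<lambda>k. z k * w))"
        by (intro continuous_intros)
      then show ?thesis
        by (simp add: continuous_on_eq_continuous_at)
    qed
    moreover have "?det (\<lambda>k. z k * 0) = 1"
      by (simp add: delay_symbol_def flip: Finite_Cartesian_Product.zero_vec_def)
    ultimately have "((\<lambda>w. ?det (\<lambda>k. z k * w)) \<longlongrightarrow> 1) (at 0)"
      by (simp add: isCont_def)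
    then have "eventually (\<lambda>w. ?det (\<lambda>k. z k * w) \<noteq> 0) (at 0)"
      by (rule tendsto_imp_eventually_ne) simp
    then obtain d where d: "d > 0" "\<And>w. w \<noteq> 0 \<Longrightarrow> cmod w < d \<Longrightarrow> ?det (\<lambda>k. z k * w) \<noteq> 0"
      by (auto simp: eventually_at)
    \<comment> \<open>The 1 keeps \<open>r\<close> in the half-plane; the other bound gives
      \<open>exp (- r) < d\<close>.\<close>
    define r where "r = max 1 (1 - ln d)"
    have "exp (- r) < d"
    proof -
      have "exp (- r) < exp (ln d)"
        unfolding exp_less_cancel_iff r_def by linarith
      then show ?thesis using d by simp
    qed
    then have "F 0 (of_real r) \<noteq> 0"
      unfolding F0 using d(2)[of "exp (- of_real r)"] by simp
    moreover have "of_real r \<in> ?S"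
      by (simp add: r_def)
    ultimately show ?thesis
      using True Ln by (metis constant_on_def)
  next
    case False
    show ?thesis
    proof (rule Hurwitz_no_zeros[of ?S "\<lambda>N. F (?u N)" "F 0" "Ln a"])
      show "open ?S"
        by (rule open_halfspace_Re_gt)
      show "connected ?S"
        by (intro convex_connected convex_halfspace_Re_gt)
      show "F (?u N) holomorphic_on ?S" for N
        unfolding F_def by (intro holomorphic_on_det_symbol holomorphic_intros)
      show "F 0 holomorphic_on ?S"
        unfolding F_def by (intro holomorphic_on_det_symbol holomorphic_intros)
      show "uniform_limit K (\<lambda>N. F (?u N)) (F 0) sequentially" if "compact K" "K \<subseteq> ?S" for K
      proof (rule uniform_limitI)
        fix e :: real assume "e > 0"
        \<comment> \<open>Joint continuity and compactness of \<open>K\<close> give closeness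
          uniform in \<open>s\<close> as \<open>u\<close> tends to 0.\<close>
        have cont: "continuous_on (UNIV \<times> K) (\<lambda>p. F (fst p) (snd p))"
          unfolding F_def \<tau>_def by (intro continuous_intros)
        obtain X where X: "0 \<in> X" "open X"
          "\<And>u s. u \<in> X \<Longrightarrow> s \<in> K \<Longrightarrow> dist (F u s) (F 0 s) \<le> e / 2"
          by (rule continuous_on_prod_compactE[OF cont \<open>compact K\<close> UNIV_I half_gt_zero[OF \<open>e > 0\<close>], of 0]) auto
        have "?u \<longlonglongrightarrow> 0"
          by (rule LIMSEQ_Suc[OF lim_1_over_n])
        then have "eventually (\<lambda>N. ?u N \<in> X) sequentially"
          using X(1,2)
          by (intro topological_tendstoD[of _ 0])
        then show "eventually (\<lambda>N. \<forall>s\<in>K. dist (F (?u N) s) (F 0 s) < e) sequentially"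
        proof eventually_elim
          case (elim N)
          then show ?case
            using X(3)[of "?u N"] \<open>e > 0\<close> by fastforce
        qed
      qed
    qed (use False nz Ln in auto)
  qed
  moreover have "exp (- Ln a) = 1 / a"
    using \<open>a \<noteq> 0\<close> by (simp add: exp_minus divide_inverse)
  ultimately have "?det (\<lambda>k. z k / a) \<noteq> 0"
    unfolding F0 by (simp add: divide_inverse)
  with \<open>a \<noteq> 0\<close> show ?thesis
    by (simp add: det_symbol_scale)
qed

section \<open>Uniform decay of powers of the symbol\<close>

primrec mat_pow :: "'a::comm_semiring_1 ^ 'n ^ 'n \<Rightarrow> nat \<Rightarrow> 'a ^ 'n ^ 'n" where
  "mat_pow A 0 = Finite_Cartesian_Product.mat 1"
| "mat_pow A (Suc n) = A ** mat_pow A n"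

lemma mat_pow_add: "mat_pow A (m + n) = mat_pow A m ** mat_pow A n"
  by (induction m) (simp_all add: matrix_mul_assoc)

text \<open>The entrywise sum norm is submultiplicative, and bounds pass easily between it and
  single entries, which is where the Fourier coefficients are estimated.\<close>

definition entry_norm :: "'a::real_normed_field ^ 'n ^ 'n \<Rightarrow> real" where
  "entry_norm A = (\<Sum>i\<in>UNIV. \<Sum>j\<in>UNIV. norm (A $ i $ j))"

lemma entry_norm_nonneg: "entry_norm A \<ge> 0"
  unfolding entry_norm_def by (intro sum_nonneg norm_ge_zero)

lemma norm_entry_le: "norm (A $ i $ j) \<le> entry_norm A"
proof -
  have "norm (A $ i $ j) \<le> (\<Sum>j\<in>UNIV. norm (A $ i $ j))"
    by (rule member_le_sum) auto
  also have "\<dots> \<le> entry_norm A"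
    unfolding entry_norm_def by (rule member_le_sum) (auto intro!: sum_nonneg)
  finally show ?thesis .
qed

lemma entry_norm_mult: "entry_norm (A ** B) \<le> entry_norm A * entry_norm B"
proof -
  have "entry_norm (A ** B) \<le> (\<Sum>i\<in>UNIV. \<Sum>j\<in>UNIV. \<Sum>k\<in>UNIV. norm (A $ i $ k) * norm (B $ k $ j))"
    unfolding entry_norm_def matrix_matrix_mult_def
    by (auto simp: norm_mult intro!: sum_mono order.trans[OF norm_sum])
  also have "\<dots> = (\<Sum>i\<in>UNIV. \<Sum>k\<in>UNIV. norm (A $ i $ k) * (\<Sum>j\<in>UNIV. norm (B $ k $ j)))"
    by (subst sum.swap) (simp add: sum_distrib_left)
  also have "\<dots> \<le> (\<Sum>i\<in>UNIV. \<Sum>k\<in>UNIV. norm (A $ i $ k) * entry_norm B)"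
    unfolding entry_norm_def[of B]
    by (intro sum_mono mult_left_mono member_le_sum) (auto intro!: sum_nonneg)
  also have "\<dots> = entry_norm A * entry_norm B"
    by (simp add: entry_norm_def[of A] sum_distrib_right)
  finally show ?thesis .
qed

lemma entry_norm_pow:
  "entry_norm (mat_pow A (L * Suc j)) \<le> entry_norm (mat_pow A L) ^ Suc j"
proof (induction j)
  case (Suc j)
  have "entry_norm (mat_pow A (L * Suc (Suc j))) \<le> entry_norm (mat_pow A L) * entry_norm (mat_pow A (L * Suc j))"
    using entry_norm_mult[of "mat_pow A L" "mat_pow A (L * Suc j)"] by (simp add: mat_pow_add[symmetric])
  also have "\<dots> \<le> entry_norm (mat_pow A L) * entry_norm (mat_pow A L) ^ Suc j"
    by (intro mult_left_mono Suc.IH entry_norm_nonneg)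
  finally show ?case by simp
qed simp

lemma norm_matrix_vector_mult_le:
  fixes A :: "real ^ 'n ^ 'n"
  shows "norm (A *v v) \<le> entry_norm A * norm v"
proof -
  have "norm (A *v v) \<le> (\<Sum>i\<in>UNIV. norm ((A *v v) $ i))"
    unfolding norm_vec_def by (rule L2_set_le_sum) simp
  also have "\<dots> \<le> (\<Sum>i\<in>UNIV. \<Sum>j\<in>UNIV. norm (A $ i $ j) * norm v)"
    unfolding matrix_vector_mult_def
    by (auto simp: abs_mult intro!: sum_mono order.trans[OF sum_abs] mult_left_mono component_le_norm_cart)
  also have "\<dots> = entry_norm A * norm v"
    by (simp add: entry_norm_def sum_distrib_right)
  finally show ?thesis .
qed

lemma norm_vector_smult:
  fixes v :: "'a::real_normed_field ^ 'n"
  shows "norm (c *s v) = norm c * norm v"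
  by (simp add: norm_vec_def norm_mult L2_set_right_distrib)

lemma contraction_recurrence_tendsto_0:
  fixes x :: "nat \<Rightarrow> real"
  assumes "0 \<le> c" "c < 1" and "e \<longlonglongrightarrow> 0" and "\<And>N. 0 \<le> x N" and "\<And>N. x (Suc N) \<le> c * x N + e N"
  shows "x \<longlonglongrightarrow> 0"
proof (rule LIMSEQ_I)
  fix r :: real assume "r > 0"
  \<comment> \<open>This choice makes r / 2 the fixed point of y -> c y + d; the other half of r is
    left for the geometric transient.\<close>
  define d where "d = (1 - c) * (r / 2)"
  have "d > 0"
    using assms \<open>r > 0\<close> by (simp add: d_def)
  then obtain N0 where N0: "\<And>N. N \<ge> N0 \<Longrightarrow> e N \<le> d"
    using LIMSEQ_D[OF assms(3), of d] by fastforce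
  have bound: "x (N0 + k) \<le> c ^ k * x N0 + r / 2" for k
  proof (induction k)
    case (Suc k)
    have "x (N0 + Suc k) \<le> c * x (N0 + k) + d"
      using assms(5)[of "N0 + k"] N0[of "N0 + k"] by simp
    also have "\<dots> \<le> c * (c ^ k * x N0 + r / 2) + d"
      using Suc assms(1) by (intro add_right_mono mult_left_mono)
    also have "\<dots> = c ^ Suc k * x N0 + r / 2"
      by (simp add: d_def field_simps)
    finally show ?case .
  qed (use assms \<open>r > 0\<close> in simp)
  have "(\<lambda>k. c ^ k * x N0) \<longlonglongrightarrow> 0 * x N0"
    using assms by (intro tendsto_intros LIMSEQ_realpow_zero)
  then obtain K where K: "\<And>k. k \<ge> K \<Longrightarrow> c ^ k * x N0 < r / 2"
    using LIMSEQ_D[of "\<lambda>k. c ^ k * x N0" 0 "r / 2"] \<open>r > 0\<close> by fastforce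
  have "norm (x N - 0) < r" if "N \<ge> N0 + K" for N
  proof -
    have "K \<le> N - N0"
      using that by linarith
    then show ?thesis
      using bound[of "N - N0"] K[of "N - N0"] that assms(4)[of N] by simp
  qed
  then show "\<exists>no. \<forall>N\<ge>no. norm (x N - 0) < r"
    by blast
qed

lemma mat_pow_commute: "mat_pow A n ** A = A ** mat_pow A n"
  using mat_pow_add[of A n 1] by simp

text \<open>Induction on the degree of a polynomial q annihilating v. Write q = (X - \<mu>) r and y
  = r(A) v, so that A y = \<mu> y. If y = 0, then r annihilates v. Otherwise |\<mu>| < 1, and r
  annihilates u = A v - \<mu> v; the recurrence A^(N+1) v = \<mu> A^N v + A^N u then contracts up to
  a null sequence.\<close>

lemma mat_pow_vec_tendsto_0_if_annihilated:
  fixes A :: "complex ^ 'n ^ 'n"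
  assumes eig: "\<And>\<mu> w. A *v w = \<mu> *s w \<Longrightarrow> w \<noteq> 0 \<Longrightarrow> cmod \<mu> < 1"
    and "degree q = n" "lead_coeff q = 1" "(\<Sum>i\<le>n. coeff q i *s (mat_pow A i *v v)) = 0"
  shows "(\<lambda>N. mat_pow A N *v v) \<longlonglongrightarrow> 0"
  using assms(2-)
proof (induction n arbitrary: q v)
  case 0
  then have "v = 0"
    by simp
  then show ?case
    by simp
next
  case (Suc n)
  obtain \<mu> r where r: "q = [:-\<mu>, 1:] * r" "degree r = n" "lead_coeff r = 1"
    using poly_obtain_linear_factor[OF Suc.prems(1,2)] .
  define y where "y = (\<Sum>i\<le>n. coeff r i *s (mat_pow A i *v v))"
  have Ay: "A *v y = (\<Sum>i\<le>n. coeff r i *s (mat_pow A i *v (A *v v)))"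
    unfolding y_def vec.linear_sum[OF matrix_vector_mul_linear_gen]
    by (simp add: vector_scalar_commute matrix_vector_mul_assoc mat_pow_commute)
  have "(\<Sum>i\<le>Suc n. coeff q i *s (mat_pow A i *v v)) =
      (\<Sum>i\<le>Suc n. (if i = 0 then 0 else coeff r (i - 1)) *s (mat_pow A i *v v)) -
      (\<Sum>i\<le>Suc n. (\<mu> * coeff r i) *s (mat_pow A i *v v))"
    unfolding r(1) coeff_linear_mult by (simp only: vector_sub_rdistrib sum_subtractf)
  also have "(\<Sum>i\<le>Suc n. (if i = 0 then 0 else coeff r (i - 1)) *s (mat_pow A i *v v)) = A *v y"
    unfolding sum.atMost_Suc_shift Ay by (simp add: matrix_vector_mul_assoc mat_pow_commute)
  also have "(\<Sum>i\<le>Suc n. (\<mu> * coeff r i) *s (mat_pow A i *v v)) = \<mu> *s y"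
    using r(2) by (simp add: coeff_eq_0 y_def vec.scale_sum_right vector_smult_assoc)
  finally have eigen: "A *v y = \<mu> *s y"
    using Suc.prems(3) by simp
  show ?case
  proof (cases "y = 0")
    case True
    then show ?thesis
      using Suc.IH[OF r(2,3)] by (simp add: y_def)
  next
    case False
    then have \<mu>: "cmod \<mu> < 1"
      using eig eigen by blast
    define u where "u = A *v v - \<mu> *s v"
    have "(\<Sum>i\<le>n. coeff r i *s (mat_pow A i *v u)) = A *v y - \<mu> *s y"
      unfolding Ay unfolding u_def y_def
      by (simp add: matrix_vector_mult_diff_distrib vector_scalar_commute vec.scale_sum_right vector_smult_assoc
          vector_ssub_ldistrib sum_subtractf mult.commute)
    then have "(\<lambda>N. mat_pow A N *v u) \<longlonglongrightarrow> 0"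
      using Suc.IH[OF r(2,3)] eigen by simp
    then have lim: "(\<lambda>N. norm (mat_pow A N *v u)) \<longlonglongrightarrow> 0"
      by (rule tendsto_norm_zero)
    have step: "norm (mat_pow A (Suc N) *v v) \<le> cmod \<mu> * norm (mat_pow A N *v v) + norm (mat_pow A N *v u)" for N
    proof -
      have "mat_pow A (Suc N) *v v = \<mu> *s (mat_pow A N *v v) + mat_pow A N *v u"
        by (simp add: u_def matrix_vector_mult_diff_distrib matrix_vector_mul_assoc mat_pow_commute vector_scalar_commute)
      then show ?thesis
        using norm_triangle_ineq[of "\<mu> *s (mat_pow A N *v v)" "mat_pow A N *v u"]
        by (simp add: norm_vector_smult del: mat_pow.simps)
    qed
    have "(\<lambda>N. norm (mat_pow A N *v v)) \<longlonglongrightarrow> 0"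
      by (rule contraction_recurrence_tendsto_0[OF norm_ge_zero \<mu> lim norm_ge_zero step])
    then show ?thesis
      by (rule tendsto_norm_zero_cancel)
  qed
qed

lemma sequence_linear_dependence:
  fixes f :: "nat \<Rightarrow> 'a::euclidean_space"
  obtains c :: "nat \<Rightarrow> real" and i where "i \<le> DIM('a)" "c i \<noteq> 0" "(\<Sum>i\<le>DIM('a). c i *\<^sub>R f i) = 0"
\<comment> \<open>Dependence of the range as a set does not see repeated values; a repetition gives
  the relation f i - f j = 0 directly.\<close>
proof (cases "inj_on f {..DIM('a)}")
  case True
  then have "card (f ` {..DIM('a)}) = Suc DIM('a)"
    by (simp add: card_image)
  then have "dependent (f ` {..DIM('a)})"
    using dependent_biggerset[of "f ` {..DIM('a)}"] by simp
  then obtain u w where "w \<in> f ` {..DIM('a)}" "u w \<noteq> 0" "(\<Sum>v\<in>f ` {..DIM('a)}. u v *\<^sub>R v) = 0"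
    unfolding real_vector.dependent_finite[OF finite_imageI[OF finite_atMost]] by blast
  then show ?thesis
    using that[of _ "\<lambda>i. u (f i)"] True by (auto simp: sum.reindex)
next
  case False
  then obtain i j where ij: "i \<le> DIM('a)" "j \<le> DIM('a)" "i \<noteq> j" "f i = f j"
    by (auto simp: inj_on_def)
  define c where "c k = (if k = i then 1 else 0) - (if k = j then 1 else (0::real))" for k
  have "(\<Sum>k\<le>DIM('a). c k *\<^sub>R f k) = (\<Sum>k\<le>DIM('a). if k = i then f k else 0) - (\<Sum>k\<le>DIM('a). if k = j then f k else 0)"
    unfolding sum_subtractf[symmetric] by (rule sum.cong) (auto simp: c_def)
  also have "\<dots> = 0"
    using ij by simp
  finally show ?thesis
    using that[of i c] ij by (simp add: c_def)
qed

text \<open>The vectors A^i v with i up to the real dimension are linearly dependent over the reals;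
  the relation, divided by its leading coefficient, is \<open>q\<close>.\<close>

lemma annihilating_poly_exists:
  fixes A :: "complex ^ 'n ^ 'n"
  obtains q :: "complex poly" where "lead_coeff q = 1" "(\<Sum>i\<le>degree q. coeff q i *s (mat_pow A i *v v)) = 0"
proof -
  let ?D = "DIM(complex ^ 'n)"
  obtain c i where c: "i \<le> ?D" "c i \<noteq> 0" "(\<Sum>i\<le>?D. c i *\<^sub>R (mat_pow A i *v v)) = 0"
    by (rule sequence_linear_dependence[of "\<lambda>i. mat_pow A i *v v"])
  define p where "p = (\<Sum>i\<le>?D. monom (complex_of_real (c i)) i)"
  have coeff_p: "coeff p k = (if k \<le> ?D then of_real (c k) else 0)" for k
    unfolding p_def coeff_sum coeff_monom by simp
  have "p \<noteq> 0"
    using c coeff_p[of i] by auto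
  define q where "q = Polynomial.smult (inverse (lead_coeff p)) p"
  have deg: "degree q = degree p"
    using \<open>p \<noteq> 0\<close> by (simp add: q_def)
  have "degree p \<le> ?D"
    by (rule degree_le) (simp add: coeff_p)
  have "(\<Sum>i\<le>degree q. coeff q i *s (mat_pow A i *v v)) = inverse (lead_coeff p) *s (\<Sum>i\<le>degree p. coeff p i *s (mat_pow A i *v v))"
    unfolding deg by (simp add: q_def vec.scale_sum_right vector_smult_assoc)
  also have "(\<Sum>i\<le>degree p. coeff p i *s (mat_pow A i *v v)) = (\<Sum>i\<le>?D. coeff p i *s (mat_pow A i *v v))"
    using \<open>degree p \<le> ?D\<close> by (intro sum.mono_neutral_left) (auto simp: coeff_eq_0)
  also have "\<dots> = (\<Sum>i\<le>?D. c i *\<^sub>R (mat_pow A i *v v))"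
  proof -
    have "complex_of_real r *s w = r *\<^sub>R w" for r and w :: "complex ^ 'n"
      by (simp add: Finite_Cartesian_Product.vec_eq_iff complex_eq_iff)
    then show ?thesis
      by (intro sum.cong) (simp_all add: coeff_p)
  qed
  finally have "(\<Sum>i\<le>degree q. coeff q i *s (mat_pow A i *v v)) = 0"
    using c by simp
  moreover have "lead_coeff q = 1"
    using \<open>p \<noteq> 0\<close> unfolding deg by (simp add: q_def)
  ultimately show ?thesis
    using that by blast
qed

lemma mat_pow_tendsto_0:
  fixes A :: "complex ^ 'n ^ 'n"
  assumes "\<And>\<mu> w. A *v w = \<mu> *s w \<Longrightarrow> w \<noteq> 0 \<Longrightarrow> cmod \<mu> < 1"
  shows "(\<lambda>N. entry_norm (mat_pow A N)) \<longlonglongrightarrow> 0"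
proof -
  have "(\<lambda>N. mat_pow A N *v v) \<longlonglongrightarrow> 0" for v
  proof -
    obtain q where "lead_coeff q = 1" "(\<Sum>i\<le>degree q. coeff q i *s (mat_pow A i *v v)) = 0"
      by (rule annihilating_poly_exists)
    then show ?thesis
      using mat_pow_vec_tendsto_0_if_annihilated[of A q _ v] assms by blast
  qed
  from tendsto_vec_nth[OF this] have "(\<lambda>N. (mat_pow A N *v axis j 1) $ i) \<longlonglongrightarrow> 0" for i j
    by simp
  moreover have "(B *v axis j 1) $ i = B $ i $ j" for B :: "complex ^ 'n ^ 'n" and i j
    by (simp add: matrix_vector_mul_component cart_eq_inner_axis[symmetric] inner_vec_def axis_def matrix_vector_mult_def if_distrib cong: if_cong)
  ultimately have "(\<lambda>N. mat_pow A N $ i $ j) \<longlonglongrightarrow> 0" for i j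
    by simp
  then have "(\<lambda>N. entry_norm (mat_pow A N)) \<longlonglongrightarrow> (\<Sum>i\<in>(UNIV::'n set). \<Sum>j\<in>(UNIV::'n set). 0)"
    unfolding entry_norm_def by (intro tendsto_sum tendsto_norm_zero)
  then show ?thesis
    by simp
qed

lemma continuous_on_mat_pow_symbol:
  fixes H :: "'m::finite \<Rightarrow> real ^ 'n ^ 'n"
  shows "continuous_on UNIV (\<lambda>z :: complex ^ 'm. mat_pow (delay_symbol H (($) z)) N $ i $ j)"
proof (induction N arbitrary: i j)
  case (Suc N)
  have "continuous_on UNIV (\<lambda>z :: complex ^ 'm. delay_symbol H (($) z) $ i $ j)" for i j
    by (auto simp: delay_symbol_def intro!: continuous_intros)
  with Suc.IH show ?case
    by (simp add: matrix_matrix_mult_def) (intro continuous_on_sum continuous_on_mult)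
qed simp

text \<open>At each point of the torus some positive power has norm below 1/2, and this persists
  nearby. By compactness finitely many exponents suffice; their product is a multiple of each, so it
  works everywhere.\<close>

lemma uniform_power_contraction:
  fixes H :: "'m::finite \<Rightarrow> real ^ 'n ^ 'n"
  assumes "\<forall>z \<mu> w. (\<forall>k. cmod (z k) = 1) \<longrightarrow> delay_symbol H z *v w = \<mu> *s w \<longrightarrow> w \<noteq> 0 \<longrightarrow> cmod \<mu> < 1"
  obtains L where "L > 0" "\<forall>z. (\<forall>k. cmod (z k) = 1) \<longrightarrow> entry_norm (mat_pow (delay_symbol H z) L) \<le> 1 / 2"
proof -
  \<comment> \<open>The torus is taken inside \<open>complex ^ 'm\<close>, where compactness is
    boundedness plus closedness.\<close>
  define T where "T = {z :: complex ^ 'm. \<forall>k. cmod (z $ k) = 1}"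
  define U where "U N = {z :: complex ^ 'm. entry_norm (mat_pow (delay_symbol H (($) z)) N) < 1 / 2}" for N
  have "closed T"
    unfolding T_def by (intro closed_Collect_all closed_Collect_eq continuous_intros)
  moreover have "norm z \<le> real CARD('m)" if "z \<in> T" for z
    using L2_set_le_sum[of UNIV "\<lambda>k. cmod (z $ k)"] that by (simp add: T_def norm_vec_def)
  then have "bounded T"
    unfolding bounded_iff by blast
  ultimately have comp: "compact T"
    by (simp add: compact_eq_bounded_closed)
  have opn: "open (U N)" for N
    unfolding U_def entry_norm_def
    by (intro open_Collect_less continuous_intros continuous_on_mat_pow_symbol)
  have cover: "T \<subseteq> (\<Union>N\<in>{0<..}. U N)"
  proof
    fix z assume "z \<in> T"
    then have "(\<lambda>N. entry_norm (mat_pow (delay_symbol H (($) z)) N)) \<longlonglongrightarrow> 0"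
      using assms by (intro mat_pow_tendsto_0) (auto simp: T_def)
    then have "eventually (\<lambda>N. entry_norm (mat_pow (delay_symbol H (($) z)) N) < 1 / 2) sequentially"
      by (rule order_tendstoD) simp
    then obtain N0 where "\<And>N. N \<ge> N0 \<Longrightarrow> z \<in> U N"
      by (auto simp: eventually_sequentially U_def)
    from this[of "Suc N0"] show "z \<in> (\<Union>N\<in>{0<..}. U N)"
      by auto
  qed
  obtain C where C: "C \<subseteq> {0<..}" "finite C" "T \<subseteq> (\<Union>N\<in>C. U N)"
    by (rule compactE_image[OF comp opn cover])
  have "\<Prod>C > 0"
    using C by (intro prod_pos) auto
  moreover have "entry_norm (mat_pow (delay_symbol H z) (\<Prod>C)) \<le> 1 / 2" if z: "\<forall>k. cmod (z k) = 1" for z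
  proof -
    define z' :: "complex ^ 'm" where "z' = (\<chi> k. z k)"
    have "z' \<in> T" "($) z' = z"
      using z by (auto simp: z'_def T_def)
    then obtain N where N: "N \<in> C" "entry_norm (mat_pow (delay_symbol H z) N) < 1 / 2"
      using C(3) by (auto simp: U_def)
    then have "N dvd \<Prod>C"
      using C(2) dvd_prodI[of C N "\<lambda>x. x"] by auto
    then obtain d where d: "\<Prod>C = N * d"
      by (auto simp: dvd_def)
    with \<open>\<Prod>C > 0\<close> obtain j where j: "d = Suc j"
      by (cases d) auto
    have "entry_norm (mat_pow (delay_symbol H z) (\<Prod>C)) \<le> entry_norm (mat_pow (delay_symbol H z) N) ^ Suc j"
      unfolding d j by (rule entry_norm_pow)
    also have "\<dots> \<le> (1 / 2) ^ Suc j"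
      using N(2) by (intro power_mono entry_norm_nonneg) simp
    also have "\<dots> \<le> 1 / 2"
      by (simp add: power_le_one)
    finally show ?thesis .
  qed
  ultimately show ?thesis
    using that by blast
qed

section \<open>Iterating the difference equation\<close>

text \<open>A word lists the delays picked in \<open>N\<close> successive substitutions of the
  equation into itself.\<close>

definition words :: "nat \<Rightarrow> 'm list set" where
  "words N = {w. length w = N}"

lemma finite_words: "finite (words N :: 'm::finite list set)"
  unfolding words_def using finite_lists_length_eq[of "UNIV :: 'm set" N] by simp

lemma words_0: "words 0 = {[]}"
  by (auto simp: words_def)

lemma sum_words_Suc:
  fixes f :: "'m::finite list \<Rightarrow> 'b::comm_monoid_add"
  shows "(\<Sum>w\<in>words (Suc N). f w) = (\<Sum>k\<in>UNIV. \<Sum>w\<in>words N. f (k # w))"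
proof -
  have "(\<Sum>w\<in>words (Suc N). f w) = (\<Sum>(k, w)\<in>UNIV \<times> words N. f (k # w))"
    by (rule sum.reindex_bij_witness[of _ "\<lambda>(k, w). k # w" "\<lambda>w. (hd w, tl w)"])
      (auto simp: words_def length_Suc_conv)
  then show ?thesis
    by (simp add: sum.cartesian_product)
qed

primrec word_mat :: "('m \<Rightarrow> real ^ 'n ^ 'n) \<Rightarrow> 'm list \<Rightarrow> real ^ 'n ^ 'n" where
  "word_mat H [] = Finite_Cartesian_Product.mat 1"
| "word_mat H (k # w) = H k ** word_mat H w"

lemma prod_count_list_Cons:
  fixes z :: "'m::finite \<Rightarrow> 'a::comm_semiring_1"
  shows "(\<Prod>l\<in>UNIV. z l ^ count_list (k # w) l) = z k * (\<Prod>l\<in>UNIV. z l ^ count_list w l)"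
proof -
  have "(\<Prod>l\<in>UNIV. z l ^ count_list (k # w) l) = (\<Prod>l\<in>UNIV. (if l = k then z l else 1) * z l ^ count_list w l)"
    by (rule prod.cong) auto
  then show ?thesis
    by (simp add: prod.distrib)
qed

lemma sum_list_map_count_list:
  fixes \<tau> :: "'m::finite \<Rightarrow> real"
  shows "sum_list (map \<tau> w) = (\<Sum>l\<in>UNIV. real (count_list w l) * \<tau> l)"
proof (induction w)
  case (Cons k w)
  have "(\<Sum>l\<in>UNIV. real (count_list (k # w) l) * \<tau> l) = (\<Sum>l\<in>UNIV. (if l = k then \<tau> l else 0) + real (count_list w l) * \<tau> l)"
    by (rule sum.cong) (auto simp: algebra_simps)
  then show ?case
    using Cons by (simp add: sum.distrib)
qed simp

text \<open>The matrices need not commute but the scalars do: the monomial of a word depends only on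
  how often each letter occurs.\<close>

lemma mat_pow_symbol_words:
  fixes H :: "'m::finite \<Rightarrow> real ^ 'n ^ 'n"
  shows "mat_pow (delay_symbol H z) N $ i $ j =
    (\<Sum>w\<in>words N. (\<Prod>l\<in>UNIV. z l ^ count_list w l) * of_real (word_mat H w $ i $ j))"
proof (induction N arbitrary: i j)
  case 0
  show ?case
    by (simp add: words_0 Finite_Cartesian_Product.mat_def)
next
  case (Suc N)
  have "mat_pow (delay_symbol H z) (Suc N) $ i $ j =
      (\<Sum>l\<in>UNIV. (\<Sum>k\<in>UNIV. z k * of_real (H k $ i $ l)) *
         (\<Sum>w\<in>words N. (\<Prod>l\<in>UNIV. z l ^ count_list w l) * of_real (word_mat H w $ l $ j)))"
    by (simp add: matrix_matrix_mult_def Suc.IH) (simp add: delay_symbol_def)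
  also have "\<dots> = (\<Sum>l\<in>UNIV. \<Sum>k\<in>UNIV. \<Sum>w\<in>words N.
      (\<Prod>l\<in>UNIV. z l ^ count_list (k # w) l) * of_real (H k $ i $ l * word_mat H w $ l $ j))"
    unfolding prod_count_list_Cons sum_product by (simp add: mult_ac)
  also have "\<dots> = (\<Sum>k\<in>UNIV. \<Sum>l\<in>UNIV. \<Sum>w\<in>words N.
      (\<Prod>l\<in>UNIV. z l ^ count_list (k # w) l) * of_real (H k $ i $ l * word_mat H w $ l $ j))"
    by (rule sum.swap)
  also have "\<dots> = (\<Sum>k\<in>UNIV. \<Sum>w\<in>words N. \<Sum>l\<in>UNIV.
      (\<Prod>l\<in>UNIV. z l ^ count_list (k # w) l) * of_real (H k $ i $ l * word_mat H w $ l $ j))"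
    by (intro sum.cong refl sum.swap)
  also have "\<dots> = (\<Sum>w\<in>words (Suc N). (\<Prod>l\<in>UNIV. z l ^ count_list w l) * of_real (word_mat H w $ i $ j))"
    unfolding sum_words_Suc by (simp add: matrix_matrix_mult_def sum_distrib_left)
  finally show ?case .
qed

text \<open>The same expansion with delays in place of phases. The bound on \<open>t\<close> keeps
  every time at which the equation is applied nonnegative.\<close>

lemma dde_solution_words:
  fixes H :: "'m::finite \<Rightarrow> real ^ 'n ^ 'n"
  assumes sol: "dde_solution H \<tau> x" and \<tau>: "\<And>k. 0 < \<tau> k" "\<And>k. \<tau> k \<le> b" and t: "t \<ge> real N * b"
  shows "x t = (\<Sum>w\<in>words N. ((-1) ^ N) *\<^sub>R (word_mat H w *v x (t - sum_list (map \<tau> w))))"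
  using t
proof (induction N arbitrary: t)
  case 0
  then show ?case
    by (simp add: words_0)
next
  case (Suc N)
  have "b \<ge> 0"
    using \<tau>[of undefined] by linarith
  then have "real (Suc N) * b \<ge> 0"
    by simp
  then have "t \<ge> 0"
    using Suc.prems by linarith
  have "x (t - \<tau> k) = (\<Sum>w\<in>words N. ((-1) ^ N) *\<^sub>R (word_mat H w *v x (t - \<tau> k - sum_list (map \<tau> w))))" for k
    using Suc.prems \<tau>(2)[of k] by (intro Suc.IH) (simp add: algebra_simps)
  then have *: "H k *v x (t - \<tau> k) =
      (\<Sum>w\<in>words N. ((-1) ^ N) *\<^sub>R (word_mat H (k # w) *v x (t - sum_list (map \<tau> (k # w)))))" for k
    by (simp add: linear_sum[OF matrix_vector_mul_linear] matrix_vector_mult_scaleR matrix_vector_mul_assoc diff_diff_eq)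
  have "x t = - (\<Sum>k\<in>UNIV. H k *v x (t - \<tau> k))"
    using sol \<open>t \<ge> 0\<close> by (simp add: dde_solution_def eq_neg_iff_add_eq_0)
  also have "\<dots> = (\<Sum>w\<in>words (Suc N). ((-1) ^ Suc N) *\<^sub>R (word_mat H w *v x (t - sum_list (map \<tau> w))))"
    unfolding * sum_words_Suc by (simp add: sum_negf)
  finally show ?case .
qed

section \<open>Fourier coefficients of the powers of the symbol\<close>

lemma sum_roots_of_unity_orthogonal:
  fixes a c M :: nat
  assumes "a < M" "c < M"
  shows "(\<Sum>j<M. cis (2 * pi * j / M) ^ c * cnj (cis (2 * pi * j / M)) ^ a) = (if c = a then of_nat M else 0)"
proof -
  define \<theta> where "\<theta> = 2 * pi * ((real c - real a) / M)"
  have power_term: "cis (2 * pi * j / M) ^ c * cnj (cis (2 * pi * j / M)) ^ a = cis \<theta> ^ j" for j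
    by (simp add: Complex.DeMoivre cis_mult cis_cnj \<theta>_def field_simps diff_divide_distrib)
  show ?thesis
  proof (cases "c = a")
    case True
    then show ?thesis
      unfolding power_term by (simp add: \<theta>_def)
  next
    case False
    \<comment> \<open>A whole number of turns would make M divide c - a, which is excluded by 0 < |c
      - a| < M; the geometric sum then vanishes.\<close>
    have "cis \<theta> \<noteq> 1"
    proof
      assume "cis \<theta> = 1"
      then have "cos \<theta> = 1"
        by (simp add: complex_eq_iff)
      then obtain k :: int where "\<theta> = of_int k * 2 * pi"
        unfolding cos_one_2pi_int by blast
      then have "(2 * pi) * ((real c - real a) / M) = (2 * pi) * of_int k"
        by (simp only: \<theta>_def mult_ac)
      then have "(real c - real a) / M = of_int k"
        by (simp only: mult_cancel_left) simp
      then have "real c - real a = of_int k * M"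
        using assms by (simp add: field_simps)
      then have "real_of_int (int c - int a) = real_of_int (k * int M)"
        by simp
      then have "int c - int a = k * int M"
        by (simp only: of_int_eq_iff)
      moreover have "\<bar>int c - int a\<bar> < int M"
        using assms by linarith
      ultimately have "\<bar>k\<bar> * int M < 1 * int M"
        by (simp add: abs_mult)
      then have "k = 0"
        by (simp only: mult_less_cancel_right) linarith
      with \<open>int c - int a = k * int M\<close> False show False
        by simp
    qed
    moreover have "cis \<theta> ^ M = 1"
    proof -
      have "real M * \<theta> = 2 * pi * of_int (int c - int a)"
        using assms by (simp add: \<theta>_def)
      then show ?thesis
        unfolding Complex.DeMoivre by (simp only: cis_multiple_2pi Ints_of_int)
    qed
    ultimately show ?thesis
      unfolding power_term using False by (simp add: geometric_sum)
  qed
qed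

text \<open>The Fourier coefficient of A(z)^N at the multi-index \<alpha>.\<close>

definition word_coeff :: "('m::finite \<Rightarrow> real ^ 'n ^ 'n) \<Rightarrow> nat \<Rightarrow> ('m \<Rightarrow> nat) \<Rightarrow> real ^ 'n ^ 'n" where
  "word_coeff H N \<alpha> = (\<Sum>w | w \<in> words N \<and> count_list w = \<alpha>. word_mat H w)"

lemma count_list_le: "count_list w l \<le> length w"
  by (induction w) auto

text \<open>Averaging over the \<open>(N + 1)\<close>-th roots of unity in each variable isolates one coefficient.\<close>
lemma word_coeff_bound:
  fixes H :: "'m::finite \<Rightarrow> real ^ 'n ^ 'n"
  assumes B: "\<And>z. (\<And>k. cmod (z k) = 1) \<Longrightarrow> cmod (mat_pow (delay_symbol H z) N $ i $ j) \<le> B"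
    and \<alpha>: "\<And>l. \<alpha> l \<le> N"
  shows "\<bar>word_coeff H N \<alpha> $ i $ j\<bar> \<le> B"
proof -
  \<comment> \<open>Exponents range over 0..N, so N + 1 sample points per variable are enough to
    tell them apart.\<close>
  define Y :: "('m \<Rightarrow> nat) set" where "Y = (\<Pi>\<^sub>E l\<in>UNIV. {..<Suc N})"
  define \<zeta> where "\<zeta> y l = cis (2 * pi * real (y l) / real (Suc N))" for y :: "'m \<Rightarrow> nat" and l
  have orth: "(\<Sum>y\<in>Y. (\<Prod>l\<in>UNIV. \<zeta> y l ^ count_list w l) * (\<Prod>l\<in>UNIV. cnj (\<zeta> y l) ^ \<alpha> l)) =
      (if count_list w = \<alpha> then of_nat (card Y) else 0)" if "w \<in> words N" for w
  proof -
    have lt: "count_list w l < Suc N" "\<alpha> l < Suc N" for l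
      using that count_list_le[of w l] \<alpha>[of l] by (auto simp: words_def)
    have "(\<Sum>y\<in>Y. (\<Prod>l\<in>UNIV. \<zeta> y l ^ count_list w l) * (\<Prod>l\<in>UNIV. cnj (\<zeta> y l) ^ \<alpha> l)) =
        (\<Sum>y\<in>Y. \<Prod>l\<in>UNIV. cis (2 * pi * real (y l) / real (Suc N)) ^ count_list w l *
           cnj (cis (2 * pi * real (y l) / real (Suc N))) ^ \<alpha> l)"
      by (simp add: prod.distrib \<zeta>_def)
    also have "\<dots> = (\<Prod>l\<in>UNIV. \<Sum>q<Suc N. cis (2 * pi * real q / real (Suc N)) ^ count_list w l *
           cnj (cis (2 * pi * real q / real (Suc N))) ^ \<alpha> l)"
      unfolding Y_def by (rule prod_sum_PiE[symmetric]) auto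
    also have "\<dots> = (\<Prod>l\<in>UNIV. if count_list w l = \<alpha> l then of_nat (Suc N) else 0)"
      using lt by (simp only: sum_roots_of_unity_orthogonal)
    also have "\<dots> = (if count_list w = \<alpha> then of_nat (card Y) else 0)"
      by (auto simp: Y_def card_PiE fun_eq_iff)
    finally show ?thesis .
  qed
  have "(\<Sum>y\<in>Y. (\<Prod>l\<in>UNIV. cnj (\<zeta> y l) ^ \<alpha> l) * mat_pow (delay_symbol H (\<zeta> y)) N $ i $ j) =
      (\<Sum>y\<in>Y. \<Sum>w\<in>words N. (\<Prod>l\<in>UNIV. \<zeta> y l ^ count_list w l) * (\<Prod>l\<in>UNIV. cnj (\<zeta> y l) ^ \<alpha> l) *
        of_real (word_mat H w $ i $ j))"
    unfolding mat_pow_symbol_words by (simp add: sum_distrib_left mult_ac)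
  also have "\<dots> = (\<Sum>w\<in>words N. \<Sum>y\<in>Y. (\<Prod>l\<in>UNIV. \<zeta> y l ^ count_list w l) * (\<Prod>l\<in>UNIV. cnj (\<zeta> y l) ^ \<alpha> l) *
        of_real (word_mat H w $ i $ j))"
    by (rule sum.swap)
  also have "\<dots> = (\<Sum>w\<in>words N. (if count_list w = \<alpha> then of_nat (card Y) else 0) * of_real (word_mat H w $ i $ j))"
    unfolding sum_distrib_right[symmetric] using orth by (intro sum.cong) simp_all
  also have "\<dots> = (\<Sum>w | w \<in> words N \<and> count_list w = \<alpha>. of_nat (card Y) * of_real (word_mat H w $ i $ j))"
    by (rule sum.mono_neutral_cong_right) (auto simp: finite_words)
  also have "\<dots> = of_real (real (card Y) * word_coeff H N \<alpha> $ i $ j)"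
    by (simp add: word_coeff_def sum_distrib_left)
  finally have "real (card Y) * \<bar>word_coeff H N \<alpha> $ i $ j\<bar> =
      cmod (\<Sum>y\<in>Y. (\<Prod>l\<in>UNIV. cnj (\<zeta> y l) ^ \<alpha> l) * mat_pow (delay_symbol H (\<zeta> y)) N $ i $ j)"
    by (simp add: abs_mult norm_mult)
  also have "\<dots> \<le> (\<Sum>y\<in>Y. B)"
    by (rule sum_norm_le) (use B in \<open>simp add: norm_mult norm_power prod_norm[symmetric] \<zeta>_def\<close>)
  also have "\<dots> = real (card Y) * B"
    by simp
  finally show ?thesis
    by (simp add: Y_def card_PiE)
qed

text \<open>Words with equal letter counts have the same total delay, so their matrices may be added
  before norms are taken. This preserves the cancellation seen by the Fourier coefficients.\<close>

lemma dde_solution_coeffs: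
  fixes H :: "'m::finite \<Rightarrow> real ^ 'n ^ 'n"
  assumes "dde_solution H \<tau> x" and "\<And>k. 0 < \<tau> k" "\<And>k. \<tau> k \<le> b" and "t \<ge> real N * b"
  shows "x t = (\<Sum>\<alpha>\<in>count_list ` words N. ((-1) ^ N) *\<^sub>R (word_coeff H N \<alpha> *v x (t - (\<Sum>l\<in>UNIV. real (\<alpha> l) * \<tau> l))))"
proof -
  have "x t = (\<Sum>w\<in>words N. ((-1) ^ N) *\<^sub>R (word_mat H w *v x (t - (\<Sum>l\<in>UNIV. real (count_list w l) * \<tau> l))))"
    using dde_solution_words[OF assms] by (simp only: sum_list_map_count_list)
  also have "\<dots> = (\<Sum>\<alpha>\<in>count_list ` words N. \<Sum>w | w \<in> words N \<and> count_list w = \<alpha>.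
      ((-1) ^ N) *\<^sub>R (word_mat H w *v x (t - (\<Sum>l\<in>UNIV. real (count_list w l) * \<tau> l))))"
    by (rule sum.image_gen) (rule finite_words)
  also have "\<dots> = (\<Sum>\<alpha>\<in>count_list ` words N. ((-1) ^ N) *\<^sub>R (word_coeff H N \<alpha> *v x (t - (\<Sum>l\<in>UNIV. real (\<alpha> l) * \<tau> l))))"
  proof (rule sum.cong[OF refl])
    fix \<alpha> :: "'m \<Rightarrow> nat"
    have "(\<Sum>w\<in>W. word_mat H w) *v y = (\<Sum>w\<in>W. word_mat H w *v y)" for W y
      by (induction W rule: infinite_finite_induct) (simp_all add: matrix_vector_mult_add_rdistrib)
    then show "(\<Sum>w | w \<in> words N \<and> count_list w = \<alpha>.
        ((-1) ^ N) *\<^sub>R (word_mat H w *v x (t - (\<Sum>l\<in>UNIV. real (count_list w l) * \<tau> l)))) =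
      ((-1) ^ N) *\<^sub>R (word_coeff H N \<alpha> *v x (t - (\<Sum>l\<in>UNIV. real (\<alpha> l) * \<tau> l)))"
      unfolding word_coeff_def by (simp add: scaleR_sum_right)
  qed
  finally show ?thesis .
qed

text \<open>Letter counts lie in {0..N}^m, so there are at most (N + 1)^m coefficients, each with
  n^2 entries bounded by B.\<close>

lemma sum_entry_norm_word_coeff_le:
  fixes H :: "'m::finite \<Rightarrow> real ^ 'n ^ 'n"
  assumes B: "\<And>z. (\<And>k. cmod (z k) = 1) \<Longrightarrow> entry_norm (mat_pow (delay_symbol H z) N) \<le> B"
  shows "(\<Sum>\<alpha>\<in>count_list ` words N. entry_norm (word_coeff H N \<alpha>)) \<le> real (Suc N) ^ CARD('m) * (real CARD('n) ^ 2 * B)"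
proof -
  have "B \<ge> 0"
    using order.trans[OF entry_norm_nonneg B[of "\<lambda>_. 1"]] by simp
  define Y :: "('m \<Rightarrow> nat) set" where "Y = (\<Pi>\<^sub>E l\<in>UNIV. {..<Suc N})"
  have sub: "count_list ` words N \<subseteq> Y"
    using count_list_le by (fastforce simp: Y_def words_def less_Suc_eq_le)
  have "finite Y"
    unfolding Y_def by (intro finite_PiE) auto
  have "(\<Sum>\<alpha>\<in>count_list ` words N. entry_norm (word_coeff H N \<alpha>)) \<le> (\<Sum>\<alpha>\<in>(count_list ` words N :: ('m \<Rightarrow> nat) set). real CARD('n) ^ 2 * B)"
  proof (rule sum_mono)
    fix \<alpha> :: "'m \<Rightarrow> nat" assume "\<alpha> \<in> count_list ` words N"
    then have le: "\<alpha> l \<le> N" for l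
      using count_list_le by (auto simp: words_def)
    have "norm (word_coeff H N \<alpha> $ i $ j) \<le> B" for i j
      using word_coeff_bound[of H N i j B \<alpha>] le B order.trans[OF norm_entry_le] by (metis real_norm_def)
    then have "entry_norm (word_coeff H N \<alpha>) \<le> (\<Sum>i\<in>(UNIV::'n set). \<Sum>j\<in>(UNIV::'n set). B)"
      unfolding entry_norm_def by (intro sum_mono)
    then show "entry_norm (word_coeff H N \<alpha>) \<le> real CARD('n) ^ 2 * B"
      by (simp add: power2_eq_square mult.assoc)
  qed
  also have "\<dots> \<le> (\<Sum>\<alpha>\<in>Y. real CARD('n) ^ 2 * B)"
    using sub \<open>finite Y\<close> \<open>B \<ge> 0\<close> by (intro sum_mono2) auto
  also have "\<dots> = real (Suc N) ^ CARD('m) * (real CARD('n) ^ 2 * B)"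
    by (simp add: Y_def card_PiE)
  finally show ?thesis .
qed

text \<open>Along N = L (j + 1) the geometric factor (1/2)^(j + 1) beats the polynomial number of
  coefficients.\<close>

lemma word_coeff_contraction:
  fixes H :: "'m::finite \<Rightarrow> real ^ 'n ^ 'n"
  assumes "\<forall>z \<mu> w. (\<forall>k. cmod (z k) = 1) \<longrightarrow> delay_symbol H z *v w = \<mu> *s w \<longrightarrow> w \<noteq> 0 \<longrightarrow> cmod \<mu> < 1"
  obtains N where "N > 0" "(\<Sum>\<alpha>\<in>count_list ` words N. entry_norm (word_coeff H N \<alpha>)) \<le> 1 / 2"
proof -
  obtain L where L: "L > 0" "\<forall>z. (\<forall>k. cmod (z k) = 1) \<longrightarrow> entry_norm (mat_pow (delay_symbol H z) L) \<le> 1 / 2"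
    by (rule uniform_power_contraction[OF assms])
  have bound: "entry_norm (mat_pow (delay_symbol H z) (L * Suc j)) \<le> (1 / 2) ^ Suc j" if "\<And>k. cmod (z k) = 1" for z j
  proof -
    have "entry_norm (mat_pow (delay_symbol H z) L) \<le> 1 / 2"
      using L(2) that by blast
    from power_mono[OF this entry_norm_nonneg, of "Suc j"] show ?thesis
      using entry_norm_pow[of "delay_symbol H z" L j] by linarith
  qed
  have "(\<lambda>j. (real L * (real j + 1) + 1) ^ CARD('m) * (real CARD('n) ^ 2 * (1 / 2) ^ Suc j)) \<longlonglongrightarrow> 0"
    using L(1) by real_asymp
  then have "eventually (\<lambda>j. (real L * (real j + 1) + 1) ^ CARD('m) * (real CARD('n) ^ 2 * (1 / 2) ^ Suc j) < 1 / 2) sequentially"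
    by (rule order_tendstoD) simp
  then obtain j where j: "(real L * (real j + 1) + 1) ^ CARD('m) * (real CARD('n) ^ 2 * (1 / 2) ^ Suc j) < 1 / 2"
    by (auto simp: eventually_sequentially)
  show ?thesis
  proof (rule that)
    show "L * Suc j > 0"
      using L(1) by simp
    have "(\<Sum>\<alpha>\<in>count_list ` words (L * Suc j). entry_norm (word_coeff H (L * Suc j) \<alpha>)) \<le>
        real (Suc (L * Suc j)) ^ CARD('m) * (real CARD('n) ^ 2 * (1 / 2) ^ Suc j)"
      by (rule sum_entry_norm_word_coeff_le) (rule bound)
    moreover have "real (Suc (L * Suc j)) = real L * (real j + 1) + 1"
      by (simp add: algebra_simps)
    ultimately show "(\<Sum>\<alpha>\<in>count_list ` words (L * Suc j). entry_norm (word_coeff H (L * Suc j) \<alpha>)) \<le> 1 / 2"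
      using j by (simp only:)
  qed
qed

section \<open>Exponential decay of solutions\<close>

text \<open>N delays add up to a lag between N a and N b, so x(t) combines values from that window
  with weights of total norm at most 1/2.\<close>

lemma dde_solution_halving:
  fixes H :: "'m::finite \<Rightarrow> real ^ 'n ^ 'n"
  assumes sol: "dde_solution H \<tau> x" and \<tau>: "\<And>k. 0 < \<tau> k" "\<And>k. a \<le> \<tau> k" "\<And>k. \<tau> k \<le> b"
    and half: "(\<Sum>\<alpha>\<in>count_list ` words N. entry_norm (word_coeff H N \<alpha>)) \<le> 1 / 2"
    and t: "t \<ge> real N * b"
    and B: "\<And>s. t - real N * b \<le> s \<Longrightarrow> s \<le> t - real N * a \<Longrightarrow> norm (x s) \<le> B"
    and "B \<ge> 0"
  shows "norm (x t) \<le> B / 2"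
proof -
  let ?C = "count_list ` words N :: ('m \<Rightarrow> nat) set"
  have "norm (word_coeff H N \<alpha> *v x (t - (\<Sum>l\<in>UNIV. real (\<alpha> l) * \<tau> l))) \<le> entry_norm (word_coeff H N \<alpha>) * B"
    if \<alpha>: "\<alpha> \<in> ?C" for \<alpha>
  proof -
    obtain w where w: "length w = N" "\<alpha> = count_list w"
      using \<alpha> unfolding words_def by blast
    have "sum_list (map \<tau> w) \<le> real (length w) * b"
      using \<tau>(3) by (induction w) (simp_all add: algebra_simps add_mono)
    moreover have "real (length w) * a \<le> sum_list (map \<tau> w)"
      using \<tau>(2) by (induction w) (simp_all add: algebra_simps add_mono)
    ultimately have "norm (x (t - (\<Sum>l\<in>UNIV. real (\<alpha> l) * \<tau> l))) \<le> B"
      unfolding w(2) sum_list_map_count_list[symmetric] w(1) by (intro B) linarith+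
    then show ?thesis
      by (intro order.trans[OF norm_matrix_vector_mult_le] mult_left_mono entry_norm_nonneg)
  qed
  then have "norm (x t) \<le> (\<Sum>\<alpha>\<in>?C. entry_norm (word_coeff H N \<alpha>) * B)"
    unfolding dde_solution_coeffs[OF sol \<tau>(1,3) t] by (intro sum_norm_le) simp
  also have "\<dots> = (\<Sum>\<alpha>\<in>?C. entry_norm (word_coeff H N \<alpha>)) * B"
    by (simp add: sum_distrib_right)
  also have "\<dots> \<le> 1 / 2 * B"
    using half \<open>B \<ge> 0\<close> by (rule mult_right_mono)
  finally show ?thesis
    by simp
qed

text \<open>Method of steps: every delay is at least \<open>a\<close>, so values up to (j + 1) a
  depend on values up to j a. The summand 1 makes the bound nondecreasing in j, so that it also
  covers the earlier times.\<close>

lemma dde_solution_growth: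
  fixes H :: "'m::finite \<Rightarrow> real ^ 'n ^ 'n"
  assumes sol: "dde_solution H \<tau> x" and \<tau>: "0 < a" "\<And>k. a \<le> \<tau> k" "\<And>k. \<tau> k \<le> b"
    and S: "\<And>s. - b \<le> s \<Longrightarrow> s \<le> 0 \<Longrightarrow> norm (x s) \<le> S"
    and t: "- b \<le> t" "t \<le> real j * a"
  shows "norm (x t) \<le> (1 + (\<Sum>k\<in>UNIV. entry_norm (H k))) ^ j * S"
  using t
proof (induction j arbitrary: t)
  case 0
  then show ?case
    using S by simp
next
  case (Suc j)
  let ?c = "\<Sum>k\<in>UNIV. entry_norm (H k)"
  have c: "?c \<ge> 0"
    by (intro sum_nonneg entry_norm_nonneg)
  have "0 \<le> b"
    using \<tau>(1) \<tau>(2,3)[of undefined] by linarith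
  then have S0: "S \<ge> 0"
    using order.trans[OF norm_ge_zero S[of 0]] by simp
  show ?case
  proof (cases "t \<le> 0")
    case True
    have "norm (x t) \<le> 1 * S"
      using S True Suc.prems(1) by simp
    also have "\<dots> \<le> (1 + ?c) ^ Suc j * S"
      using c S0 by (intro mult_right_mono one_le_power) auto
    finally show ?thesis .
  next
    case False
    have "norm (H k *v x (t - \<tau> k)) \<le> entry_norm (H k) * ((1 + ?c) ^ j * S)" for k
    proof -
      have "norm (x (t - \<tau> k)) \<le> (1 + ?c) ^ j * S"
        using False Suc.prems \<tau>(2,3)[of k] by (intro Suc.IH) (simp_all add: algebra_simps)
      then show ?thesis
        by (intro order.trans[OF norm_matrix_vector_mult_le] mult_left_mono entry_norm_nonneg)
    qed
    then have "norm (\<Sum>k\<in>UNIV. H k *v x (t - \<tau> k)) \<le> (\<Sum>k\<in>UNIV. entry_norm (H k) * ((1 + ?c) ^ j * S))"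
      by (intro sum_norm_le)
    moreover have "x t = - (\<Sum>k\<in>UNIV. H k *v x (t - \<tau> k))"
      using sol False by (simp add: dde_solution_def eq_neg_iff_add_eq_0)
    ultimately have "norm (x t) \<le> ?c * ((1 + ?c) ^ j * S)"
      by (simp add: sum_distrib_right)
    also have "\<dots> \<le> (1 + ?c) * ((1 + ?c) ^ j * S)"
      using c S0 by (intro mult_right_mono mult_nonneg_nonneg zero_le_power) auto
    finally show ?thesis
      by (simp add: mult.assoc)
  qed
qed

text \<open>The rate is chosen so that the envelope exactly doubles when moved back by T, which the
  halving compensates. The induction advances by \<open>d\<close>, since the window ending at t - d
  then lies in the range already treated.\<close>

lemma exponential_decay_if_halving:
  fixes f :: "real \<Rightarrow> real"
  assumes "0 < d" "0 < T" "0 \<le> K"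
    and init: "\<And>t. 0 \<le> t \<Longrightarrow> t \<le> T \<Longrightarrow> f t \<le> K"
    and half: "\<And>t B. T \<le> t \<Longrightarrow> 0 \<le> B \<Longrightarrow> (\<And>s. t - T \<le> s \<Longrightarrow> s \<le> t - d \<Longrightarrow> f s \<le> B) \<Longrightarrow> f t \<le> B / 2"
    and "0 \<le> t"
  shows "f t \<le> 2 * K * exp (- (ln 2 / T) * t)"
proof -
  define \<alpha> where "\<alpha> = ln 2 / T"
  have \<alpha>: "\<alpha> > 0" "exp (\<alpha> * T) = 2"
    using assms by (simp_all add: \<alpha>_def)
  have "f t \<le> 2 * K * exp (- \<alpha> * t)" if "0 \<le> t" "t \<le> T + real i * d" for i t
    using that
  proof (induction i arbitrary: t)
    case 0
    \<comment> \<open>The factor 2 in the envelope is what keeps it above K on all of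
      [0, T].\<close>
    have "K * exp (\<alpha> * t) \<le> K * 2"
      unfolding \<alpha>(2)[symmetric] using 0 \<alpha>(1) \<open>0 \<le> K\<close> by (intro mult_left_mono) auto
    then have "K \<le> 2 * K * exp (- \<alpha> * t)"
      by (simp add: exp_minus field_simps)
    then show ?case
      using init[of t] 0 by simp
  next
    case (Suc i)
    show ?case
    proof (cases "t \<le> T")
      case True
      then show ?thesis
        using Suc.prems \<open>0 < d\<close> by (intro Suc.IH) (auto intro: order.trans)
    next
      case False
      define B where "B = 2 * K * exp (- \<alpha> * (t - T))"
      have "f t \<le> B / 2"
      proof (rule half)
        show "T \<le> t" "0 \<le> B"
          using False \<open>0 \<le> K\<close> by (simp_all add: B_def)
        fix s assume s: "t - T \<le> s" "s \<le> t - d"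
        have "f s \<le> 2 * K * exp (- \<alpha> * s)"
          using s False Suc.prems by (intro Suc.IH) (auto simp: algebra_simps)
        also have "\<dots> \<le> B"
          unfolding B_def using s(1) \<alpha>(1) \<open>0 \<le> K\<close> by (intro mult_left_mono) auto
        finally show "f s \<le> B" .
      qed
      also have "B / 2 = 2 * K * exp (- \<alpha> * t)"
      proof -
        have "exp (- \<alpha> * (t - T)) = exp (- \<alpha> * t) * exp (\<alpha> * T)"
          by (simp add: exp_add[symmetric] algebra_simps)
        then show ?thesis
          by (simp add: B_def \<alpha>(2))
      qed
      finally show ?thesis .
    qed
  qed
  moreover obtain i where "t / d \<le> real i"
    using real_arch_simple by blast
  then have "t \<le> T + real i * d"
    using assms by (simp add: field_simps)
  ultimately show ?thesis
    using \<open>0 \<le> t\<close> unfolding \<alpha>_def by blast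
qed

lemma exponentially_stable_if_contraction:
  fixes H :: "'m::finite \<Rightarrow> real ^ 'n ^ 'n"
  assumes "N > 0" and half: "(\<Sum>\<alpha>\<in>count_list ` words N. entry_norm (word_coeff H N \<alpha>)) \<le> 1 / 2"
    and pos: "\<And>k. 0 < \<tau> k"
  shows "exponentially_stable H \<tau>"
proof -
  define a where "a = Min (range \<tau>)"
  define b where "b = max_delay \<tau>"
  define T where "T = real N * b"
  have bounds: "a \<le> \<tau> k" "\<tau> k \<le> b" for k
    by (simp_all add: a_def b_def max_delay_def)
  have "a > 0"
    using pos by (auto simp: a_def)
  have "b > 0"
    using pos[of undefined] bounds(2)[of undefined] by linarith
  then have "T > 0"
    using \<open>N > 0\<close> by (simp add: T_def)
  \<comment> \<open>\<open>j\<close> steps of length \<open>a\<close> cover [0, T], so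
    \<open>G\<close> bounds the solution there relative to its history.\<close>
  obtain j :: nat where j: "T / a \<le> real j"
    using real_arch_simple by blast
  define G where "G = (1 + (\<Sum>k\<in>UNIV. entry_norm (H k))) ^ j"
  have "G \<ge> 0"
    unfolding G_def by (intro zero_le_power add_nonneg_nonneg sum_nonneg entry_norm_nonneg) auto
  have "norm (x t) \<le> (2 * G) * exp (- (ln 2 / T) * t) * (SUP s\<in>{- b..0}. norm (x s))"
    if sol: "dde_solution H \<tau> x" and "t \<ge> 0" for x t
  proof -
    define S where "S = (SUP s\<in>{- b..0}. norm (x s))"
    \<comment> \<open>Continuity on the compact history interval makes the supremum an actual upper
      bound.\<close>
    have "continuous_on {- b..0} (\<lambda>s. norm (x s))"
      using sol by (auto simp: dde_solution_def b_def intro!: continuous_intros elim: continuous_on_subset)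
    then have "bdd_above ((\<lambda>s. norm (x s)) ` {- b..0})"
      by (intro bounded_imp_bdd_above compact_imp_bounded compact_continuous_image) auto
    then have S: "norm (x s) \<le> S" if "- b \<le> s" "s \<le> 0" for s
      unfolding S_def using that by (intro cSUP_upper) auto
    have "S \<ge> 0"
      using order.trans[OF norm_ge_zero S[of 0]] \<open>b > 0\<close> by simp
    have init: "norm (x s) \<le> G * S" if "0 \<le> s" "s \<le> T" for s
    proof -
      have "s \<le> real j * a"
        using that(2) j \<open>a > 0\<close> by (simp add: field_simps)
      then show ?thesis
        unfolding G_def using that \<open>b > 0\<close>
        by (intro dde_solution_growth[OF sol \<open>a > 0\<close> bounds S]) auto
    qed
    have "norm (x t) \<le> 2 * (G * S) * exp (- (ln 2 / T) * t)"
    proof (rule exponential_decay_if_halving[of "real N * a" T])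
      show "0 < real N * a" "0 \<le> G * S"
        using \<open>N > 0\<close> \<open>a > 0\<close> \<open>G \<ge> 0\<close> \<open>S \<ge> 0\<close> by simp_all
      show "norm (x s) \<le> B / 2" if "T \<le> s" "0 \<le> B" "\<And>r. s - T \<le> r \<Longrightarrow> r \<le> s - real N * a \<Longrightarrow> norm (x r) \<le> B" for s B
        using that unfolding T_def by (intro dde_solution_halving[OF sol pos bounds half]) auto
    qed (use \<open>T > 0\<close> init \<open>t \<ge> 0\<close> in auto)
    then show ?thesis
      unfolding S_def by (simp add: mult_ac)
  qed
  moreover have "ln 2 / T > 0"
    using \<open>T > 0\<close> by simp
  ultimately show ?thesis
    unfolding exponentially_stable_def b_def by blast
qed

section \<open>Strong stability in terms of roots, and the equivalence\<close>

lemma strongly_stable_iff_roots: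
  fixes H :: "'m::finite \<Rightarrow> real ^ 'n ^ 'n"
  shows "strongly_stable H \<longleftrightarrow> (\<forall>z. (\<forall>k. cmod (z k) = 1) \<longrightarrow>
    (\<forall>a. Determinants.det (Finite_Cartesian_Product.mat a + delay_symbol H z) = 0 \<longrightarrow> cmod a < 1))"
    (is "_ \<longleftrightarrow> ?roots")
proof
  assume stable: "strongly_stable H"
  show ?roots
  proof (intro allI impI)
    fix z :: "'m \<Rightarrow> complex" and a :: complex
    assume z: "\<forall>k. cmod (z k) = 1" and a: "Determinants.det (Finite_Cartesian_Product.mat a + delay_symbol H z) = 0"
    have "cmod a \<noteq> 1" "\<not> cmod a > 1"
      using strongly_stable_root_not_unit[OF stable, of z a] strongly_stable_root_not_outside[OF stable, of z a] z a
      by auto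
    then show "cmod a < 1"
      by linarith
  qed
next
  assume roots: ?roots
  have "cmod \<mu> < 1" if z: "\<forall>k. cmod (z k) = 1" and eig: "delay_symbol H z *v w = \<mu> *s w" "w \<noteq> 0" for z \<mu> w
  proof -
    \<comment> \<open>The roots of the characteristic polynomial are the negatives of the
      eigenvalues of A(z), with the same moduli.\<close>
    have "(Finite_Cartesian_Product.mat (- \<mu>) + delay_symbol H z) *v w = 0"
    proof -
      have "Finite_Cartesian_Product.mat (- \<mu>) *v w = - (\<mu> *s w)"
        by (simp add: Finite_Cartesian_Product.vec_eq_iff matrix_vector_mult_def Finite_Cartesian_Product.mat_def
            if_distrib[of "\<lambda>c. c * _"] cong: if_cong)
      then show ?thesis
        using eig by (simp add: matrix_vector_mult_add_rdistrib)
    qed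
    then have "Determinants.det (Finite_Cartesian_Product.mat (- \<mu>) + delay_symbol H z) = 0"
      using eig(2) det_eq_0_iff_kernel by blast
    then have "cmod (- \<mu>) < 1"
      using roots z by blast
    then show ?thesis
      by simp
  qed
  then have "\<forall>z \<mu> w. (\<forall>k. cmod (z k) = 1) \<longrightarrow> delay_symbol H z *v w = \<mu> *s w \<longrightarrow> w \<noteq> 0 \<longrightarrow> cmod \<mu> < 1"
    by blast
  then obtain N where "N > 0" "(\<Sum>\<alpha>\<in>count_list ` words N. entry_norm (word_coeff H N \<alpha>)) \<le> 1 / 2"
    by (rule word_coeff_contraction)
  then show "strongly_stable H"
    unfolding strongly_stable_def using exponentially_stable_if_contraction by blast
qed

theorem mainTheorem1:
  fixes H :: "'m::finite \<Rightarrow> real ^ 'n ^ 'n"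
  shows "strongly_stable H \<longleftrightarrow>
    (\<forall>z :: 'm \<Rightarrow> complex. (\<forall>k. norm (z k) = 1) \<longrightarrow>
       positive_definite_mat (hermite_mat CARD('n) (char_poly_at H z)))"
  unfolding strongly_stable_iff_roots hermite_positive_iff_roots ..

end
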